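(* Let $D>4$ and let $B=(B^{\mu\nu}_{ij})$, with $\mu,\nu,i,j\in\{1,\dots,D\}$, be a real array that is antisymmetric in $(\mu,\nu)$ and antisymmetric in $(i,j)$. Assume $B$ is generic, i.e. the linear map from antisymmetric arrays $\theta_{\mu\nu}$ to antisymmetric arrays in $(i,j)$ given by $\theta\mapsto \sum_{\mu,\nu}B^{\mu\nu}_{ij}\theta_{\mu\nu}$ is invertible. Then the following are equivalent: (1) there exist real coefficients $c^{[m]}_{[\alpha]}$ (indexed by multi-indices $[m]=(m_1,\dots,m_{D-4})$ and $[\alpha]=(\alpha_1,\dots,\alpha_{D-4})$) such that for all $[m]$ and all $\mu,\nu,\rho,\sigma$, $$\sum_{i,j,k,l}\epsilon^{m_1\cdots m_{D-4}\,ijkl}\,B^{\mu\nu}_{ij}B^{\rho\sigma}_{kl}=\sum_{\alpha_1,\dots,\alpha_{D-4}}\epsilon^{\alpha_1\cdots\alpha_{D-4}\,\mu\nu\rho\sigma}\,c^{[m]}_{[\alpha]};$$ (2) there exists a real $D\times D$ matrix $(e^\mu_i)$ and a sign such that $B^{\mu\nu}_{ij}=\pm|e|\,e^{[\mu}_i e^{\nu]}_j$ for all $\mu,\nu,i,j$, where $|e|$ is the absolute value of $\det(e^\mu_i)$.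
   Context: $\epsilon$ denotes the totally antisymmetric Levi-Civita symbol in $D$ indices (with $\epsilon^{12\cdots D}=1$). Antisymmetrization brackets denote $e^{[\mu}_i e^{\nu]}_j=\tfrac12(e^\mu_i e^\nu_j-e^\nu_i e^\mu_j)$. (Here $B$ is the value at a point of the $\mathfrak{so}(D)$-valued bivector field of the BF formulation of $D$-dimensional Euclidean gravity; condition (1) is the set of equations obtained by varying the Lagrange multipliers, and (2) says $B$ comes from a frame field.) *)

theory Defs
  imports Complex_Main "HOL-Combinatorics.Permutations"
begin

text \<open>Indices run over {0..<D} (0-based; index k stands for k+1).
  Arrays are functions nat => ... => real, only their values on {0..<D} matter.\<close>

definition levi_civita :: "nat \<Rightarrow> nat list \<Rightarrow> real" where
  "levi_civita D xs =
     (if length xs = D \<and> distinct xs \<and> set xs \<subseteq> {..<D}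
      then of_int (sign (\<lambda>k. if k < D then xs ! k else k)) else 0)"

definition det_nat :: "nat \<Rightarrow> (nat \<Rightarrow> nat \<Rightarrow> real) \<Rightarrow> real" where
  "det_nat D e = (\<Sum>p | p permutes {..<D}. of_int (sign p) * (\<Prod>i<D. e i (p i)))"

definition antisym2 :: "nat \<Rightarrow> (nat \<Rightarrow> nat \<Rightarrow> real) \<Rightarrow> bool" where
  "antisym2 D t \<longleftrightarrow> (\<forall>a<D. \<forall>b<D. t a b = - t b a)"

definition bivector_array :: "nat \<Rightarrow> (nat \<Rightarrow> nat \<Rightarrow> nat \<Rightarrow> nat \<Rightarrow> real) \<Rightarrow> bool" where
  "bivector_array D B \<longleftrightarrow>
     (\<forall>\<mu><D. \<forall>\<nu><D. \<forall>i<D. \<forall>j<D. B \<mu> \<nu> i j = - B \<nu> \<mu> i j \<and> B \<mu> \<nu> i j = - B \<mu> \<nu> j i)"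

definition B_map :: "nat \<Rightarrow> (nat \<Rightarrow> nat \<Rightarrow> nat \<Rightarrow> nat \<Rightarrow> real) \<Rightarrow> (nat \<Rightarrow> nat \<Rightarrow> real) \<Rightarrow> nat \<Rightarrow> nat \<Rightarrow> real" where
  "B_map D B \<theta> i j = (\<Sum>\<mu><D. \<Sum>\<nu><D. B \<mu> \<nu> i j * \<theta> \<mu> \<nu>)"

definition generic_B :: "nat \<Rightarrow> (nat \<Rightarrow> nat \<Rightarrow> nat \<Rightarrow> nat \<Rightarrow> real) \<Rightarrow> bool" where
  "generic_B D B \<longleftrightarrow>
     (\<forall>\<phi>. antisym2 D \<phi> \<longrightarrow> (\<exists>\<theta>. antisym2 D \<theta> \<and> (\<forall>i<D. \<forall>j<D. B_map D B \<theta> i j = \<phi> i j))) \<and>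
     (\<forall>\<theta>. antisym2 D \<theta> \<longrightarrow> (\<forall>i<D. \<forall>j<D. B_map D B \<theta> i j = 0) \<longrightarrow> (\<forall>\<mu><D. \<forall>\<nu><D. \<theta> \<mu> \<nu> = 0))"

definition multi_indices :: "nat \<Rightarrow> nat \<Rightarrow> nat list set" where
  "multi_indices D n = {xs. length xs = n \<and> set xs \<subseteq> {..<D}}"

end

theory Submission
  imports Defs "Jordan_Normal_Form.Determinant"
begin

text \<open>Condition (1) says that \<open>B \<mu> \<nu> \<and> B \<rho> \<sigma>\<close>, as a 4-form in the lower indices, is totally antisymmetric
  in the upper ones. Hence all \<open>B \<mu> \<nu>\<close> are simple, and those sharing the index \<open>\<mu>\<close> are planes that meet
  pairwise. As there are at least four of them and they are independent, these planes have a common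
  line, spanned by \<open>e \<mu>\<close>, so \<open>B \<mu> \<nu> = b \<mu> \<nu> (e \<mu> \<and> e \<nu>)\<close>. Antisymmetry then gives
  \<open>b \<mu> \<nu> b \<rho> \<sigma> = b \<mu> \<rho> b \<nu> \<sigma>\<close>, which forces \<open>b \<mu> \<nu> = \<plusminus> r \<mu> r \<nu>\<close>; the frame is \<open>r \<mu> e \<mu>\<close> up to a
  global scale that produces the determinant factor.\<close>

section \<open>Simple 2-forms and their common factors\<close>

text \<open>The bound \<open>D > 4\<close> is sharp. For \<open>D = 4\<close> each index has only
  three partners, and three planes that meet pairwise may lie in a common 3-space instead of sharing
  a line; the dual family, with \<open>B 0 1\<close> proportional to the wedge of the frame vectors
  2 and 3 and so on, realises this case. A second obstacle is that the lines found for different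
  indices could coincide: a family \<open>e \<and> h \<mu> \<nu>\<close> with one fixed
  \<open>e\<close> has vanishing wedge products altogether. Genericity excludes it, used there as
  surjectivity, whereas independence of the bivectors is its injectivity. The sign in (2) is
  genuine: absorbing it into the frame vectors would need real numbers with
  \<open>r \<mu> * r \<nu> = - 1\<close> for all distinct indices, which is impossible for three or
  more of them.\<close>

definition wedge11 :: "('i \<Rightarrow> real) \<Rightarrow> ('i \<Rightarrow> real) \<Rightarrow> 'i \<Rightarrow> 'i \<Rightarrow> real" where
  "wedge11 u v = (\<lambda>i j. u i * v j - u j * v i)"

definition wedge12 :: "('i \<Rightarrow> real) \<Rightarrow> ('i \<Rightarrow> 'i \<Rightarrow> real) \<Rightarrow> 'i \<Rightarrow> 'i \<Rightarrow> 'i \<Rightarrow> real" where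
  "wedge12 u \<phi> = (\<lambda>i j k. u i * \<phi> j k + u j * \<phi> k i + u k * \<phi> i j)"

text \<open>The exterior product as a sum over the six (2,2)-shuffles, without normalising factor;
  it is meant for antisymmetric arguments.\<close>

definition wedge22 :: "('i \<Rightarrow> 'i \<Rightarrow> real) \<Rightarrow> ('i \<Rightarrow> 'i \<Rightarrow> real) \<Rightarrow> 'i \<Rightarrow> 'i \<Rightarrow> 'i \<Rightarrow> 'i \<Rightarrow> real" where
  "wedge22 \<phi> \<psi> = (\<lambda>i j k l. \<phi> i j * \<psi> k l + \<phi> k l * \<psi> i j - \<phi> i k * \<psi> j l - \<phi> j l * \<psi> i k
     + \<phi> i l * \<psi> j k + \<phi> j k * \<psi> i l)"

text \<open>A nonzero simple form stands for a plane, and its nonzero divisors are exactly the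
  nonzero vectors of that plane. A nonzero common divisor thus spans a common line.\<close>

definition divides_form :: "('i \<Rightarrow> real) \<Rightarrow> ('i \<Rightarrow> 'i \<Rightarrow> real) \<Rightarrow> bool" where
  "divides_form e \<phi> \<longleftrightarrow> (\<exists>h. \<phi> = wedge11 e h)"

lemmas wedge_defs = wedge11_def wedge12_def wedge22_def

lemma wedge22_commute: "wedge22 \<phi> \<psi> = wedge22 \<psi> \<phi>"
  by (auto simp: wedge22_def fun_eq_iff)

lemma divides_formI: "divides_form e (wedge11 e h)"
  by (auto simp: divides_form_def)

lemma wedge22_common_factor:
  assumes "divides_form e \<phi>" and "divides_form e \<psi>"
  shows "wedge22 \<phi> \<psi> = (\<lambda>i j k l. 0)"
proof -
  obtain h where h: "\<phi> = wedge11 e h" using assms by (auto simp: divides_form_def)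
  obtain k where k: "\<psi> = wedge11 e k" using assms by (auto simp: divides_form_def)
  show ?thesis unfolding h k by (simp add: wedge11_def wedge22_def fun_eq_iff algebra_simps)
qed

text \<open>Where \<open>\<phi> a b\<close> is nonzero, the component \<open>a b c d\<close> of the
  hypothesis is the Pluecker relation. It writes \<open>\<phi> c d\<close> as a 2 by 2 determinant
  in the rows \<open>a\<close> and \<open>b\<close> of \<open>\<phi>\<close>, divided by
  \<open>\<phi> a b\<close>.\<close>

lemma simple_form:
  assumes anti: "\<And>i j. \<phi> i j = - \<phi> j i" and null: "wedge22 \<phi> \<phi> = (\<lambda>i j k l. 0)"
  shows "\<exists>u v. \<phi> = wedge11 u v"
proof (cases "\<phi> = (\<lambda>i j. 0)")
  case True
  then show ?thesis by (intro exI[of _ "\<lambda>i. 0"]) (simp add: wedge11_def)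
next
  case False
  then obtain a b where ab: "\<phi> a b \<noteq> 0" by (auto simp: fun_eq_iff)
  have "\<phi> c d = wedge11 (\<phi> a) (\<lambda>i. \<phi> b i / \<phi> a b) c d" for c d
  proof -
    have "wedge22 \<phi> \<phi> a b c d = 0" using null by simp
    then have "\<phi> a b * \<phi> c d = \<phi> a c * \<phi> b d - \<phi> a d * \<phi> b c"
      by (simp add: wedge22_def algebra_simps)
    then show ?thesis using ab by (simp add: wedge11_def field_simps)
  qed
  then show ?thesis by blast
qed

text \<open>Cramer's rule: the 3 by 3 determinant of \<open>u\<close>, \<open>v\<close>,
  \<open>w\<close> is expanded along the running column \<open>c\<close> and solved for
  \<open>w c\<close>, whose coefficient is the nonzero minor.\<close>

lemma wedge12_eq_0_imp_span:
  assumes "wedge11 u v a b \<noteq> 0" and "\<And>c. wedge12 u (wedge11 v w) a b c = 0"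
  shows "\<exists>\<alpha> \<beta>. w = (\<lambda>i. \<alpha> * u i + \<beta> * v i)"
proof -
  define m where "m = wedge11 u v a b"
  have m0: "m \<noteq> 0" using assms(1) m_def by simp
  have "w c = (- wedge11 v w a b / m) * u c + (wedge11 u w a b / m) * v c" for c
  proof -
    have "m * w c = wedge11 u w a b * v c - wedge11 v w a b * u c"
      using assms(2)[of c] by (simp add: wedge_defs m_def algebra_simps)
    then show ?thesis using m0 by (simp add: field_simps)
  qed
  then show ?thesis by blast
qed

text \<open>Cramer's rule one dimension higher, with a 3 by 3 minor as pivot and \<open>d\<close> as
  the running column.\<close>

lemma wedge22_eq_0_imp_span:
  assumes "wedge12 u (wedge11 v w) a b c \<noteq> 0"
    and "\<And>d. wedge22 (wedge11 u v) (wedge11 w z) a b c d = 0"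
  shows "\<exists>\<alpha> \<beta> \<gamma>. z = (\<lambda>i. \<alpha> * u i + \<beta> * v i + \<gamma> * w i)"
proof -
  define m where "m = wedge12 u (wedge11 v w) a b c"
  have m0: "m \<noteq> 0" using assms(1) m_def by simp
  have "z d = (wedge12 v (wedge11 w z) a b c / m) * u d + (- wedge12 u (wedge11 w z) a b c / m) * v d
     + (wedge12 u (wedge11 v z) a b c / m) * w d" for d
  proof -
    have "m * z d = wedge12 v (wedge11 w z) a b c * u d - wedge12 u (wedge11 w z) a b c * v d
       + wedge12 u (wedge11 v z) a b c * w d"
      using assms(2)[of d] by (simp add: wedge_defs m_def algebra_simps)
    from arg_cong[OF this, of "\<lambda>x. x / m"] have "z d = (wedge12 v (wedge11 w z) a b c * u d
       - wedge12 u (wedge11 w z) a b c * v d + wedge12 u (wedge11 v z) a b c * w d) / m"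
      using m0 by simp
    then show ?thesis by (simp add: add_divide_distrib diff_divide_distrib)
  qed
  then show ?thesis by blast
qed

lemma wedge22_eq_0_dependent:
  assumes "wedge11 u v a b \<noteq> 0" and "wedge22 (wedge11 u v) (wedge11 w z) = (\<lambda>i j k l. 0)"
  shows "(\<exists>\<alpha> \<beta>. w = (\<lambda>i. \<alpha> * u i + \<beta> * v i)) \<or> (\<exists>\<alpha> \<beta> \<gamma>. z = (\<lambda>i. \<alpha> * u i + \<beta> * v i + \<gamma> * w i))"
proof (cases "\<forall>c. wedge12 u (wedge11 v w) a b c = 0")
  case True
  then show ?thesis using wedge12_eq_0_imp_span[OF assms(1)] by blast
next
  case False
  then obtain c where c: "wedge12 u (wedge11 v w) a b c \<noteq> 0" by blast
  have "wedge22 (wedge11 u v) (wedge11 w z) a b c d = 0" for d using assms(2) by simp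
  from wedge22_eq_0_imp_span[OF c this] show ?thesis by blast
qed

lemma span_divides_form:
  assumes "\<alpha> \<noteq> 0 \<or> \<beta> \<noteq> 0"
  shows "divides_form (\<lambda>i. \<alpha> * u i + \<beta> * v i) (wedge11 u v)"
proof (cases "\<alpha> = 0")
  case False
  then have "wedge11 u v = wedge11 (\<lambda>i. \<alpha> * u i + \<beta> * v i) (\<lambda>i. v i / \<alpha>)"
    by (auto simp: wedge11_def fun_eq_iff field_simps)
  then show ?thesis by (auto simp: divides_form_def)
next
  case True
  then have "wedge11 u v = wedge11 (\<lambda>i. \<alpha> * u i + \<beta> * v i) (\<lambda>i. - u i / \<beta>)"
    using assms by (auto simp: wedge11_def fun_eq_iff field_simps)
  then show ?thesis by (auto simp: divides_form_def)
qed

text \<open>A vanishing 4-form bounds the joint span by dimension three, so the planes meet in a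
  line. That line is spanned by \<open>w\<close> itself or by \<open>z - \<gamma> * w\<close>; the
  coefficients cannot both vanish because \<open>w\<close> and \<open>z\<close> are
  independent.\<close>

lemma null_pair_common_factor:
  assumes "wedge11 u v \<noteq> (\<lambda>i j. 0)" and nz: "wedge11 w z \<noteq> (\<lambda>i j. 0)"
    and "wedge22 (wedge11 u v) (wedge11 w z) = (\<lambda>i j k l. 0)"
  shows "\<exists>\<alpha> \<beta>. (\<alpha> \<noteq> 0 \<or> \<beta> \<noteq> 0) \<and> divides_form (\<lambda>i. \<alpha> * u i + \<beta> * v i) (wedge11 w z)"
proof -
  obtain a b where "wedge11 u v a b \<noteq> 0" using assms(1) by (auto simp: fun_eq_iff)
  from wedge22_eq_0_dependent[OF this assms(3)] show ?thesis
  proof (elim disjE exE)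
    fix \<alpha> \<beta> assume w: "w = (\<lambda>i. \<alpha> * u i + \<beta> * v i)"
    have "\<alpha> \<noteq> 0 \<or> \<beta> \<noteq> 0" using nz by (auto simp: w wedge11_def fun_eq_iff)
    then show ?thesis using w divides_formI by blast
  next
    fix \<alpha> \<beta> \<gamma> assume z: "z = (\<lambda>i. \<alpha> * u i + \<beta> * v i + \<gamma> * w i)"
    have *: "wedge11 w z = wedge11 (\<lambda>i. \<alpha> * u i + \<beta> * v i) (\<lambda>i. - w i)"
      by (auto simp: z wedge11_def fun_eq_iff algebra_simps)
    have "\<alpha> \<noteq> 0 \<or> \<beta> \<noteq> 0" using nz unfolding * by (auto simp: wedge11_def fun_eq_iff)
    then show ?thesis using * divides_formI by metis
  qed
qed

text \<open>As \<open>p\<close> divides \<open>\<phi>\<close>, the wedge of \<open>p\<close> with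
  \<open>\<phi> = q \<and> k\<close> vanishes, so \<open>k\<close> lies in the span of
  \<open>p\<close> and \<open>q\<close>.\<close>

lemma two_factors:
  assumes p: "divides_form p \<phi>" and q: "divides_form q \<phi>" and ab: "wedge11 p q a b \<noteq> 0"
  shows "\<exists>c. \<phi> = (\<lambda>i j. c * wedge11 p q i j)"
proof -
  obtain h where h: "\<phi> = wedge11 p h" using p by (auto simp: divides_form_def)
  obtain k where k: "\<phi> = wedge11 q k" using q by (auto simp: divides_form_def)
  have "wedge12 p (wedge11 q k) = wedge12 p (wedge11 p h)" using h k by simp
  then have "wedge12 p (wedge11 q k) a b c = 0" for c
    by (simp add: wedge_defs algebra_simps)
  from wedge12_eq_0_imp_span[OF ab this] obtain \<alpha> \<beta> where "k = (\<lambda>i. \<alpha> * p i + \<beta> * q i)" by blast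
  then have "\<phi> = (\<lambda>i j. (- \<alpha>) * wedge11 p q i j)" using k
    by (simp add: wedge11_def fun_eq_iff algebra_simps)
  then show ?thesis by blast
qed

lemma parallel_forms:
  assumes "wedge11 p q = (\<lambda>i j. 0)" and "p \<noteq> (\<lambda>i. 0)"
  shows "\<exists>c. q = (\<lambda>i. c * p i)"
proof -
  obtain a where a: "p a \<noteq> 0" using assms(2) by (auto simp: fun_eq_iff)
  have "q i = q a / p a * p i" for i
    using fun_cong[OF fun_cong[OF assms(1), of a], of i] a
    by (simp add: wedge11_def field_simps)
  then show ?thesis by blast
qed

section \<open>Independent planes that meet pairwise\<close>

definition lin_indep2 :: "('i \<Rightarrow> 'i \<Rightarrow> real) \<Rightarrow> ('i \<Rightarrow> 'i \<Rightarrow> real) \<Rightarrow> bool" where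
  "lin_indep2 \<phi> \<psi> \<longleftrightarrow> (\<forall>x y. (\<forall>i j. x * \<phi> i j + y * \<psi> i j = 0) \<longrightarrow> x = 0 \<and> y = 0)"

definition lin_indep4 :: "('i \<Rightarrow> 'i \<Rightarrow> real) \<Rightarrow> ('i \<Rightarrow> 'i \<Rightarrow> real) \<Rightarrow> ('i \<Rightarrow> 'i \<Rightarrow> real) \<Rightarrow> ('i \<Rightarrow> 'i \<Rightarrow> real) \<Rightarrow> bool" where
  "lin_indep4 \<phi> \<psi> \<chi> \<omega> \<longleftrightarrow> (\<forall>x y z t. (\<forall>i j. x * \<phi> i j + y * \<psi> i j + z * \<chi> i j + t * \<omega> i j = 0)
     \<longrightarrow> x = 0 \<and> y = 0 \<and> z = 0 \<and> t = 0)"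

lemma lin_indep4D:
  assumes "lin_indep4 \<phi> \<psi> \<chi> \<omega>"
  shows "lin_indep2 \<phi> \<psi>" "\<phi> \<noteq> (\<lambda>i j. 0)" "\<psi> \<noteq> (\<lambda>i j. 0)" "\<chi> \<noteq> (\<lambda>i j. 0)" "\<omega> \<noteq> (\<lambda>i j. 0)"
proof -
  have L: "(\<forall>i j. x * \<phi> i j + y * \<psi> i j + z * \<chi> i j + t * \<omega> i j = 0)
     \<Longrightarrow> x = 0 \<and> y = 0 \<and> z = 0 \<and> t = 0" for x y z t
    using assms unfolding lin_indep4_def by blast
  show "lin_indep2 \<phi> \<psi>"
    unfolding lin_indep2_def
  proof (intro allI impI)
    fix x y assume "\<forall>i j. x * \<phi> i j + y * \<psi> i j = 0"
    then show "x = 0 \<and> y = 0" using L[of x y 0 0] by simp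
  qed
  show "\<phi> \<noteq> (\<lambda>i j. 0)" using L[of 1 0 0 0] by auto
  show "\<psi> \<noteq> (\<lambda>i j. 0)" using L[of 0 1 0 0] by auto
  show "\<chi> \<noteq> (\<lambda>i j. 0)" using L[of 0 0 1 0] by auto
  show "\<omega> \<noteq> (\<lambda>i j. 0)" using L[of 0 0 0 1] by auto
qed

text \<open>Two different planes share at most one line: if \<open>p\<close> and \<open>q\<close>
  were not parallel, both forms would be multiples of their wedge.\<close>

lemma common_factor_unique:
  assumes "lin_indep2 \<phi> \<psi>"
    and "divides_form p \<phi>" "divides_form p \<psi>" "divides_form q \<phi>" "divides_form q \<psi>"
  shows "\<exists>c. q = (\<lambda>i. c * p i)"
proof (rule parallel_forms)
  have L: "(\<forall>i j. x * \<phi> i j + y * \<psi> i j = 0) \<Longrightarrow> x = 0 \<and> y = 0" for x y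
    using assms(1) unfolding lin_indep2_def by blast
  show "wedge11 p q = (\<lambda>i j. 0)"
  proof (rule ccontr)
    assume "wedge11 p q \<noteq> (\<lambda>i j. 0)"
    then obtain a b where ab: "wedge11 p q a b \<noteq> 0" by (auto simp: fun_eq_iff)
    obtain c where c: "\<phi> = (\<lambda>i j. c * wedge11 p q i j)" using two_factors[OF assms(2,4) ab] by blast
    obtain d where d: "\<psi> = (\<lambda>i j. d * wedge11 p q i j)" using two_factors[OF assms(3,5) ab] by blast
    have "\<forall>i j. d * \<phi> i j + (- c) * \<psi> i j = 0" by (simp add: c d)
    then have "c = 0" using L[of d "- c"] by simp
    then show False using L[of 1 0] c by simp
  qed
  show "p \<noteq> (\<lambda>i. 0)"
  proof
    assume "p = (\<lambda>i. 0)"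
    then have "\<phi> = (\<lambda>i j. 0)" using assms(2) by (auto simp: divides_form_def wedge11_def)
    then show False using L[of 1 0] by simp
  qed
qed

text \<open>The scalar moves into the cofactor, so \<open>c = 0\<close> is allowed.\<close>

lemma divides_form_scale:
  assumes "divides_form (\<lambda>i. c * p i) \<phi>"
  shows "divides_form p \<phi>"
proof -
  obtain h where "\<phi> = wedge11 (\<lambda>i. c * p i) h" using assms by (auto simp: divides_form_def)
  then have "\<phi> = wedge11 p (\<lambda>i. c * h i)" by (simp add: wedge11_def fun_eq_iff algebra_simps)
  then show ?thesis by (auto simp: divides_form_def)
qed

text \<open>The plane of \<open>w\<close> and \<open>z\<close> meets both given planes. If it avoids
  their common line \<open>e\<close>, the two meeting lines can be normalised to
  \<open>f + \<alpha> * e\<close> and \<open>g + \<beta> * e\<close>, and they span it; so it lies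
  in the 3-space of \<open>e\<close>, \<open>f\<close>, \<open>g\<close>.\<close>

lemma null_to_pencil:
  assumes ind: "lin_indep2 (wedge11 e f) (wedge11 e g)"
    and nz: "wedge11 w z \<noteq> (\<lambda>i j. 0)"
    and nf: "wedge22 (wedge11 e f) (wedge11 w z) = (\<lambda>i j k l. 0)"
    and ng: "wedge22 (wedge11 e g) (wedge11 w z) = (\<lambda>i j k l. 0)"
  shows "divides_form e (wedge11 w z) \<or>
    (\<exists>\<alpha> \<beta> c. c \<noteq> 0 \<and> wedge11 w z = (\<lambda>i j. c * wedge11 (\<lambda>i. f i + \<alpha> * e i) (\<lambda>i. g i + \<beta> * e i) i j))"
proof (subst disj_commute, rule disjCI)
  assume nd: "\<not> divides_form e (wedge11 w z)"
  have L: "(\<forall>i j. x * wedge11 e f i j + y * wedge11 e g i j = 0) \<Longrightarrow> x = 0 \<and> y = 0" for x y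
    using ind unfolding lin_indep2_def by blast
  have ex: "\<exists>\<alpha>. divides_form (\<lambda>i. h i + \<alpha> * e i) (wedge11 w z)"
    if e: "wedge11 e h \<noteq> (\<lambda>i j. 0)" and n: "wedge22 (wedge11 e h) (wedge11 w z) = (\<lambda>i j k l. 0)" for h
  proof -
    obtain \<alpha> \<beta> where ab: "\<alpha> \<noteq> 0 \<or> \<beta> \<noteq> 0" and d: "divides_form (\<lambda>i. \<alpha> * e i + \<beta> * h i) (wedge11 w z)"
      using null_pair_common_factor[OF e nz n] by blast
    have "\<beta> \<noteq> 0"
    proof
      assume "\<beta> = 0"
      then have "divides_form (\<lambda>i. \<alpha> * e i) (wedge11 w z)" using d by simp
      then show False using nd divides_form_scale by blast
    qed
    then have "(\<lambda>i. \<alpha> * e i + \<beta> * h i) = (\<lambda>i. \<beta> * (h i + \<alpha> / \<beta> * e i))"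
      by (auto simp: fun_eq_iff field_simps)
    then have "divides_form (\<lambda>i. \<beta> * (h i + \<alpha> / \<beta> * e i)) (wedge11 w z)" using d by simp
    from divides_form_scale[OF this] show ?thesis by blast
  qed
  have "wedge11 e f \<noteq> (\<lambda>i j. 0)" using L[of 1 0] by auto
  then obtain \<alpha> where \<alpha>: "divides_form (\<lambda>i. f i + \<alpha> * e i) (wedge11 w z)" using ex nf by blast
  have "wedge11 e g \<noteq> (\<lambda>i j. 0)" using L[of 0 1] by auto
  then obtain \<beta> where \<beta>: "divides_form (\<lambda>i. g i + \<beta> * e i) (wedge11 w z)" using ex ng by blast
  let ?F = "\<lambda>i. f i + \<alpha> * e i" and ?G = "\<lambda>i. g i + \<beta> * e i"
  \<comment> \<open>If the two meeting lines coincided, \<open>g\<close> would be a combination of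
    \<open>e\<close> and \<open>f\<close>, making \<open>e \<and> g\<close> a multiple of
    \<open>e \<and> f\<close>.\<close>
  have "wedge11 ?F ?G \<noteq> (\<lambda>i j. 0)"
  proof
    assume FG: "wedge11 ?F ?G = (\<lambda>i j. 0)"
    have F0: "?F \<noteq> (\<lambda>i. 0)"
    proof
      assume "?F = (\<lambda>i. 0)"
      then have "f = (\<lambda>i. - \<alpha> * e i)" by (simp add: fun_eq_iff add_eq_0_iff)
      then have "wedge11 e f = (\<lambda>i j. 0)" by (simp add: wedge11_def fun_eq_iff)
      then show False using L[of 1 0] by auto
    qed
    obtain c where "?G = (\<lambda>i. c * ?F i)" using parallel_forms[OF FG F0] by blast
    then have g: "g = (\<lambda>i. c * (f i + \<alpha> * e i) - \<beta> * e i)" by (auto simp: fun_eq_iff algebra_simps)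
    have "\<forall>i j. (- c) * wedge11 e f i j + 1 * wedge11 e g i j = 0"
      by (simp add: g wedge11_def algebra_simps)
    then show False using L by fastforce
  qed
  then obtain a b where "wedge11 ?F ?G a b \<noteq> 0" by (auto simp: fun_eq_iff)
  from two_factors[OF \<alpha> \<beta> this] obtain c where c: "wedge11 w z = (\<lambda>i j. c * wedge11 ?F ?G i j)" by blast
  moreover have "c \<noteq> 0" using nz c by (auto simp: fun_eq_iff)
  ultimately show "\<exists>\<alpha> \<beta> c. c \<noteq> 0 \<and> wedge11 w z = (\<lambda>i j. c * wedge11 (\<lambda>i. f i + \<alpha> * e i) (\<lambda>i. g i + \<beta> * e i) i j)"
    by blast
qed

text \<open>The factor \<open>e\<close> of \<open>\<chi> = e \<and> h\<close> kills the
  \<open>e\<close>-parts of \<open>\<omega>\<close>, so their product is a multiple of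
  \<open>e \<and> f \<and> g \<and> h\<close>. If that vanishes, a relation among the four vectors,
  wedged with \<open>e\<close>, relates \<open>e \<and> f\<close>, \<open>e \<and> g\<close> and
  \<open>e \<and> h\<close>.\<close>

lemma mixed_null_contradiction:
  assumes ind: "lin_indep4 (wedge11 e f) (wedge11 e g) \<chi> \<omega>"
    and e: "divides_form e \<chi>"
    and \<omega>: "\<omega> = (\<lambda>i j. c * wedge11 (\<lambda>i. f i + \<alpha> * e i) (\<lambda>i. g i + \<beta> * e i) i j)"
    and null: "wedge22 \<chi> \<omega> = (\<lambda>i j k l. 0)"
  shows False
proof -
  have L: "(\<forall>i j. x * wedge11 e f i j + y * wedge11 e g i j + z * \<chi> i j + t * \<omega> i j = 0)
     \<Longrightarrow> x = 0 \<and> y = 0 \<and> z = 0 \<and> t = 0" for x y z t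
    using ind unfolding lin_indep4_def by blast
  have c0: "c \<noteq> 0" using L[of 0 0 0 1] \<omega> by auto
  obtain h where h: "\<chi> = wedge11 e h" using e by (auto simp: divides_form_def)
  have n: "wedge22 (wedge11 e f) (wedge11 g h) = (\<lambda>i j k l. 0)"
  proof (intro ext)
    fix i j k l
    have "c * wedge22 (wedge11 e f) (wedge11 g h) i j k l = wedge22 \<chi> \<omega> i j k l"
      by (simp add: h \<omega> wedge11_def wedge22_def algebra_simps)
    then show "wedge22 (wedge11 e f) (wedge11 g h) i j k l = 0" using null c0 by simp
  qed
  have "wedge11 e f \<noteq> (\<lambda>i j. 0)" using L[of 1 0 0 0] by auto
  then obtain a b where "wedge11 e f a b \<noteq> 0" by (auto simp: fun_eq_iff)
  from wedge22_eq_0_dependent[OF this n] show False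
  proof (elim disjE exE)
    fix \<alpha> \<beta> assume "g = (\<lambda>i. \<alpha> * e i + \<beta> * f i)"
    then show False using L[of "- \<beta>" 1 0 0] by (simp add: wedge11_def algebra_simps)
  next
    fix \<alpha> \<beta> \<gamma> assume "h = (\<lambda>i. \<alpha> * e i + \<beta> * f i + \<gamma> * g i)"
    then show False using L[of "- \<beta>" "- \<gamma>" 1 0] by (simp add: h wedge11_def algebra_simps)
  qed
qed

text \<open>Pairwise intersecting planes either share a line or lie in a common 3-space; four independent
  forms rule out the second case because the bivectors of a 3-space form a 3-dimensional space.\<close>

lemma four_null_common_factor:
  assumes ind: "lin_indep4 \<phi>1 \<phi>2 \<phi>3 \<phi>4"
    and s: "\<exists>u v. \<phi>1 = wedge11 u v" "\<exists>u v. \<phi>2 = wedge11 u v" "\<exists>u v. \<phi>3 = wedge11 u v" "\<exists>u v. \<phi>4 = wedge11 u v"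
    and n: "wedge22 \<phi>1 \<phi>2 = (\<lambda>i j k l. 0)" "wedge22 \<phi>1 \<phi>3 = (\<lambda>i j k l. 0)" "wedge22 \<phi>1 \<phi>4 = (\<lambda>i j k l. 0)"
      "wedge22 \<phi>2 \<phi>3 = (\<lambda>i j k l. 0)" "wedge22 \<phi>2 \<phi>4 = (\<lambda>i j k l. 0)" "wedge22 \<phi>3 \<phi>4 = (\<lambda>i j k l. 0)"
  shows "\<exists>e. divides_form e \<phi>1 \<and> divides_form e \<phi>2 \<and> divides_form e \<phi>3 \<and> divides_form e \<phi>4"
proof -
  note L = lin_indep4D[OF ind]
  obtain e f g where 1: "\<phi>1 = wedge11 e f" and 2: "\<phi>2 = wedge11 e g"
  proof -
    obtain u v w z where uv: "\<phi>1 = wedge11 u v" and wz: "\<phi>2 = wedge11 w z" using s by blast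
    obtain \<alpha> \<beta> where "\<alpha> \<noteq> 0 \<or> \<beta> \<noteq> 0" "divides_form (\<lambda>i. \<alpha> * u i + \<beta> * v i) \<phi>2"
      using null_pair_common_factor[of u v w z] L n(1) uv wz by blast
    then show ?thesis using that span_divides_form[of \<alpha> \<beta> u v] uv by (auto simp: divides_form_def)
  qed
  have cases: "divides_form e \<chi> \<or>
    (\<exists>\<alpha> \<beta> c. c \<noteq> 0 \<and> \<chi> = (\<lambda>i j. c * wedge11 (\<lambda>i. f i + \<alpha> * e i) (\<lambda>i. g i + \<beta> * e i) i j))"
    if "\<exists>u v. \<chi> = wedge11 u v" "\<chi> \<noteq> (\<lambda>i j. 0)" "wedge22 \<phi>1 \<chi> = (\<lambda>i j k l. 0)" "wedge22 \<phi>2 \<chi> = (\<lambda>i j k l. 0)" for \<chi>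
    using that null_to_pencil[of e f g] L(1) 1 2 by blast
  \<comment> \<open>The last two forms are exchanged so that the mixed case can be refuted with
    either of them containing \<open>e\<close>.\<close>
  have ind': "lin_indep4 \<phi>1 \<phi>2 \<phi>4 \<phi>3"
    unfolding lin_indep4_def
  proof (intro allI impI)
    fix x y z t assume "\<forall>i j. x * \<phi>1 i j + y * \<phi>2 i j + z * \<phi>4 i j + t * \<phi>3 i j = 0"
    then have "\<forall>i j. x * \<phi>1 i j + y * \<phi>2 i j + t * \<phi>3 i j + z * \<phi>4 i j = 0" by (simp add: add_ac)
    then show "x = 0 \<and> y = 0 \<and> z = 0 \<and> t = 0" using ind unfolding lin_indep4_def by blast
  qed
  have n': "wedge22 \<phi>4 \<phi>3 = (\<lambda>i j k l. 0)" using n(6) wedge22_commute by metis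
  from cases[OF s(3) L(4) n(2,4)] cases[OF s(4) L(5) n(3,5)]
  have "divides_form e \<phi>3 \<and> divides_form e \<phi>4"
  proof (elim disjE exE conjE)
    fix \<alpha> \<beta> c assume "divides_form e \<phi>3"
      "\<phi>4 = (\<lambda>i j. c * wedge11 (\<lambda>i. f i + \<alpha> * e i) (\<lambda>i. g i + \<beta> * e i) i j)"
    then show ?thesis using mixed_null_contradiction ind n(6) 1 2 by blast
  next
    fix \<alpha> \<beta> c assume "divides_form e \<phi>4"
      "\<phi>3 = (\<lambda>i j. c * wedge11 (\<lambda>i. f i + \<alpha> * e i) (\<lambda>i. g i + \<beta> * e i) i j)"
    then show ?thesis using mixed_null_contradiction ind' n' 1 2 by blast
  next
    fix \<alpha> \<beta> c \<alpha>' \<beta>' c' assume c: "c \<noteq> 0" "c' \<noteq> 0"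
      and 3: "\<phi>3 = (\<lambda>i j. c * wedge11 (\<lambda>i. f i + \<alpha> * e i) (\<lambda>i. g i + \<beta> * e i) i j)"
      and 4: "\<phi>4 = (\<lambda>i j. c' * wedge11 (\<lambda>i. f i + \<alpha>' * e i) (\<lambda>i. g i + \<beta>' * e i) i j)"
    \<comment> \<open>After division by \<open>c\<close> and \<open>c'\<close> both forms have the
      same \<open>f \<and> g\<close> part. It cancels in the difference, leaving only multiples of
      \<open>e \<and> f\<close> and \<open>e \<and> g\<close>.\<close>
    have "\<forall>i j. (c * c' * (\<beta> - \<beta>')) * \<phi>1 i j + (c * c' * (\<alpha>' - \<alpha>)) * \<phi>2 i j + c' * \<phi>3 i j + (- c) * \<phi>4 i j = 0"
      unfolding 1 2 3 4 wedge11_def by (simp add: algebra_simps)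
    then show ?thesis using ind c unfolding lin_indep4_def by blast
  qed blast
  then show ?thesis using 1 2 divides_formI by blast
qed

section \<open>Duality by the Levi-Civita symbol\<close>

lemma list_permutes:
  assumes "length xs = D" "distinct xs" "set xs \<subseteq> {..<D}"
  shows "(\<lambda>k. if k < D then xs ! k else k) permutes {..<D}"
proof (rule bij_imp_permutes)
  have "bij_betw ((!) xs) {..<D} {..<D}"
  proof -
    have "set xs = {..<D}"
      by (rule card_subset_eq) (use assms distinct_card[OF assms(2)] in auto)
    then show ?thesis by (intro bij_betw_nth) (simp_all add: assms)
  qed
  then show "bij_betw (\<lambda>k. if k < D then xs ! k else k) {..<D} {..<D}"
    by (rule bij_betw_cong[THEN iffD1, rotated]) simp
qed simp

text \<open>Exchanging neighbouring entries composes the permutation given by the list with an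
  adjacent transposition on the right. A list that is not a permutation stays so, and both symbols
  are 0.\<close>

lemma levi_civita_swap:
  "levi_civita D (xs @ b # a # ys) = - levi_civita D (xs @ a # b # ys)"
proof (cases "length (xs @ a # b # ys) = D \<and> distinct (xs @ a # b # ys) \<and> set (xs @ a # b # ys) \<subseteq> {..<D}")
  case True
  let ?u = "xs @ a # b # ys" and ?v = "xs @ b # a # ys"
  let ?n = "length xs"
  let ?f = "\<lambda>k. if k < D then ?u ! k else k" and ?g = "\<lambda>k. if k < D then ?v ! k else k"
  have v: "length ?v = D \<and> distinct ?v \<and> set ?v \<subseteq> {..<D}" using True by auto
  have n: "Suc ?n < D" using True by auto
  have g: "?g = ?f \<circ> transpose ?n (Suc ?n)"
  proof
    fix k
    consider "k = ?n" | "k = Suc ?n" | "k < ?n" | "k > Suc ?n" by linarith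
    then show "?g k = (?f \<circ> transpose ?n (Suc ?n)) k"
    proof cases
      case 4
      then have "k - ?n = Suc (Suc (k - ?n - 2))" by simp
      then show ?thesis using 4 n by (auto simp: nth_append transpose_def split: if_splits)
    qed (use n in \<open>auto simp: nth_append transpose_def\<close>)
  qed
  have f: "permutation ?f" using list_permutes True permutation_permutes by (metis finite_lessThan)
  have "sign ?g = sign ?f * sign (transpose ?n (Suc ?n))"
    unfolding g by (rule sign_compose[OF f permutation_swap_id])
  then have "sign ?g = - sign ?f" by (simp add: sign_swap_id)
  then show ?thesis using True v by (simp only: levi_civita_def if_True of_int_minus simp_thms)
next
  case False
  then have "\<not> (length (xs @ b # a # ys) = D \<and> distinct (xs @ b # a # ys) \<and> set (xs @ b # a # ys) \<subseteq> {..<D})"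
    by auto
  then show ?thesis using False by (simp only: levi_civita_def if_False)
qed

lemma levi_civita_square:
  assumes "length xs = D" "distinct xs" "set xs \<subseteq> {..<D}"
  shows "levi_civita D xs * levi_civita D xs = 1"
proof -
  have "levi_civita D xs = of_int (sign (\<lambda>k. if k < D then xs ! k else k))"
    using assms by (simp only: levi_civita_def) simp
  then show ?thesis by (metis of_int_1 of_int_mult sign_idempotent)
qed

lemma levi_civita_swap4:
  "levi_civita D (ms @ [b, a, c, d]) = - levi_civita D (ms @ [a, b, c, d])"
  "levi_civita D (ms @ [a, c, b, d]) = - levi_civita D (ms @ [a, b, c, d])"
  "levi_civita D (ms @ [a, b, d, c]) = - levi_civita D (ms @ [a, b, c, d])"
  using levi_civita_swap[of D ms b a "[c, d]"] levi_civita_swap[of D "ms @ [a]" c b "[d]"]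
    levi_civita_swap[of D "ms @ [a, b]" d c "[]"] by simp_all

text \<open>Adjacent transpositions generate all permutations. The 23 nontrivial ones are spelled
  out, each one transposition away from an earlier one, so that instances at fixed indices serve as
  rewrite rules; the swap laws themselves would rewrite back and forth.\<close>

lemma antisym4_perms:
  fixes L :: "'i \<Rightarrow> 'i \<Rightarrow> 'i \<Rightarrow> 'i \<Rightarrow> real"
  assumes s1: "\<And>a b c d. L b a c d = - L a b c d"
    and s2: "\<And>a b c d. L a c b d = - L a b c d"
    and s3: "\<And>a b c d. L a b d c = - L a b c d"
  shows "L a b d c = - L a b c d" "L a c b d = - L a b c d" "L b a c d = - L a b c d"
    "L a c d b = L a b c d" "L a d b c = L a b c d" "L b a d c = L a b c d"
    "L b c a d = L a b c d" "L c a b d = L a b c d" "L a d c b = - L a b c d"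
    "L b c d a = - L a b c d" "L b d a c = - L a b c d" "L c a d b = - L a b c d"
    "L c b a d = - L a b c d" "L d a b c = - L a b c d" "L b d c a = L a b c d"
    "L c b d a = L a b c d" "L c d a b = L a b c d" "L d a c b = L a b c d"
    "L d b a c = L a b c d" "L c d b a = - L a b c d" "L d b c a = - L a b c d"
    "L d c a b = - L a b c d" "L d c b a = L a b c d"
proof -
  show abdc: "L a b d c = - L a b c d" using s3[of a b c d] by simp
  show acbd: "L a c b d = - L a b c d" using s2[of a b c d] by simp
  show bacd: "L b a c d = - L a b c d" using s1[of a b c d] by simp
  show acdb: "L a c d b = L a b c d" using s3[of a c b d] acbd by simp
  show adbc: "L a d b c = L a b c d" using s2[of a b d c] abdc by simp
  show badc: "L b a d c = L a b c d" using s1[of a b d c] abdc by simp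
  show bcad: "L b c a d = L a b c d" using s2[of b a c d] bacd by simp
  show cabd: "L c a b d = L a b c d" using s1[of a c b d] acbd by simp
  show adcb: "L a d c b = - L a b c d" using s2[of a c d b] acdb by simp
  show bcda: "L b c d a = - L a b c d" using s3[of b c a d] bcad by simp
  show bdac: "L b d a c = - L a b c d" using s2[of b a d c] badc by simp
  show cadb: "L c a d b = - L a b c d" using s1[of a c d b] acdb by simp
  show cbad: "L c b a d = - L a b c d" using s1[of b c a d] bcad by simp
  show dabc: "L d a b c = - L a b c d" using s1[of a d b c] adbc by simp
  show bdca: "L b d c a = L a b c d" using s2[of b c d a] bcda by simp
  show cbda: "L c b d a = L a b c d" using s1[of b c d a] bcda by simp
  show cdab: "L c d a b = L a b c d" using s2[of c a d b] cadb by simp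
  show dacb: "L d a c b = L a b c d" using s1[of a d c b] adcb by simp
  show dbac: "L d b a c = L a b c d" using s1[of b d a c] bdac by simp
  show cdba: "L c d b a = - L a b c d" using s2[of c b d a] cbda by simp
  show dbca: "L d b c a = - L a b c d" using s1[of b d c a] bdca by simp
  show dcab: "L d c a b = - L a b c d" using s1[of c d a b] cdab by simp
  show dcba: "L d c b a = L a b c d" using s1[of c d b a] cdba by simp
qed

lemma antisym4_zero:
  fixes L :: "'i \<Rightarrow> 'i \<Rightarrow> 'i \<Rightarrow> 'i \<Rightarrow> real"
  assumes s1: "\<And>a b c d. L b a c d = - L a b c d"
    and s2: "\<And>a b c d. L a c b d = - L a b c d"
    and s3: "\<And>a b c d. L a b d c = - L a b c d"
  shows "L a a c d = 0" "L a b a d = 0" "L a b c a = 0" "L a b b d = 0" "L a b c b = 0" "L a b c c = 0"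
  using antisym4_perms[where L = L and a = a and b = a and c = c and d = d, OF s1 s2 s3]
    antisym4_perms[where L = L and a = a and b = b and c = a and d = d, OF s1 s2 s3]
    antisym4_perms[where L = L and a = a and b = b and c = c and d = a, OF s1 s2 s3] antisym4_perms[where L = L and a = a and b = b and c = b and d = d, OF s1 s2 s3]
    antisym4_perms[where L = L and a = a and b = b and c = c and d = b, OF s1 s2 s3] antisym4_perms[where L = L and a = a and b = b and c = c and d = c, OF s1 s2 s3]
  by linarith+

text \<open>Of the 256 terms only the 24 rearrangements of \<open>a\<close>, \<open>b\<close>,
  \<open>c\<close>, \<open>d\<close> survive, each with the sign of its permutation.\<close>

lemma sum4_antisym:
  fixes L :: "'i \<Rightarrow> 'i \<Rightarrow> 'i \<Rightarrow> 'i \<Rightarrow> real"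
  assumes s1: "\<And>a b c d. L b a c d = - L a b c d"
    and s2: "\<And>a b c d. L a c b d = - L a b c d"
    and s3: "\<And>a b c d. L a b d c = - L a b c d"
    and dist: "distinct [a, b, c, d]"
  defines "S \<equiv> {a, b, c, d}"
  shows "(\<Sum>i\<in>S. \<Sum>j\<in>S. \<Sum>k\<in>S. \<Sum>l\<in>S. L i j k l * F i j k l) = L a b c d * (
      F a b c d - F a b d c - F a c b d - F b a c d + F a c d b + F a d b c
      + F b a d c + F b c a d + F c a b d - F a d c b - F b c d a - F b d a c
      - F c a d b - F c b a d - F d a b c + F b d c a + F c b d a + F c d a b
      + F d a c b + F d b a c - F c d b a - F d b c a - F d c a b + F d c b a)"
proof -
  note z = antisym4_zero[of L, OF s1 s2 s3]
  note p = antisym4_perms[where L = L and a = a and b = b and c = c and d = d, OF s1 s2 s3]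
  have S: "(\<Sum>i\<in>S. G i) = G a + G b + G c + G d" for G :: "'i \<Rightarrow> real"
    using dist unfolding S_def by simp
  show ?thesis unfolding S by (simp add: z p algebra_simps)
qed

text \<open>The symbol restricts all four sums to the complement of \<open>ms\<close>. The factor 4
  arises because swapping within \<open>i j\<close> or within \<open>k l\<close> leaves each term
  unchanged, so each of the six shuffles is counted four times.\<close>

lemma levi_civita_wedge22:
  fixes \<phi> \<psi> :: "nat \<Rightarrow> nat \<Rightarrow> real"
  assumes dist: "distinct (ms @ [a, b, c, d])" and set: "set (ms @ [a, b, c, d]) = {..<D}"
    and \<phi>: "antisym2 D \<phi>" and \<psi>: "antisym2 D \<psi>"
  shows "(\<Sum>i<D. \<Sum>j<D. \<Sum>k<D. \<Sum>l<D. levi_civita D (ms @ [i, j, k, l]) * \<phi> i j * \<psi> k l)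
    = 4 * levi_civita D (ms @ [a, b, c, d]) * wedge22 \<phi> \<psi> a b c d"
proof -
  define L where "L i j k l = levi_civita D (ms @ [i, j, k, l])" for i j k l
  define S where "S = {a, b, c, d}"
  have s: "L b a c d = - L a b c d" "L a c b d = - L a b c d" "L a b d c = - L a b c d" for a b c d
    unfolding L_def by (rule levi_civita_swap4)+
  have S: "S \<subseteq> {..<D}" "{..<D} - S = set ms" using dist set by (auto simp: S_def)
  have z: "L i j k l = 0" if "i \<in> set ms \<or> j \<in> set ms \<or> k \<in> set ms \<or> l \<in> set ms" for i j k l
    using that unfolding L_def levi_civita_def by auto
  have restrict: "sum G {..<D} = sum G S" if "\<And>i. i \<in> set ms \<Longrightarrow> G i = 0" for G :: "nat \<Rightarrow> real"
    by (rule sum.mono_neutral_right) (use S that in auto)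
  have "(\<Sum>i<D. \<Sum>j<D. \<Sum>k<D. \<Sum>l<D. L i j k l * \<phi> i j * \<psi> k l)
     = (\<Sum>i\<in>S. \<Sum>j\<in>S. \<Sum>k\<in>S. \<Sum>l\<in>S. L i j k l * (\<phi> i j * \<psi> k l))"
    by (simp add: restrict z mult.assoc)
  also have "\<dots> = 4 * L a b c d * wedge22 \<phi> \<psi> a b c d"
  proof -
    have lt: "a < D" "b < D" "c < D" "d < D" using set by auto
    have A: "b < D \<Longrightarrow> a < D \<Longrightarrow> \<phi> b a = - \<phi> a b" "b < D \<Longrightarrow> a < D \<Longrightarrow> \<psi> b a = - \<psi> a b" for a b
      using \<phi> \<psi> unfolding antisym2_def by blast+
    note A' = A[of b a] A[of c a] A[of d a] A[of c b] A[of d b] A[of d c]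
    have d4: "distinct [a, b, c, d]" using dist by simp
    show ?thesis unfolding S_def sum4_antisym[of L, OF s d4, where F = "\<lambda>i j k l. \<phi> i j * \<psi> k l"]
      by (simp add: A' lt wedge22_def algebra_simps)
  qed
  finally show ?thesis unfolding L_def .
qed

text \<open>Every 4-index antisymmetric array is an epsilon-dual: it is enough to put the coefficients on
  increasing multi-indices, each of which determines its complementary quadruple.\<close>

lemma antisym4_epsilon_dual:
  fixes F :: "nat \<Rightarrow> nat \<Rightarrow> nat \<Rightarrow> nat \<Rightarrow> real"
  assumes D: "4 \<le> D"
    and s1: "\<And>a b c d. F b a c d = - F a b c d"
    and s2: "\<And>a b c d. F a c b d = - F a b c d"
    and s3: "\<And>a b c d. F a b d c = - F a b c d"
  shows "\<exists>c. \<forall>\<mu><D. \<forall>\<nu><D. \<forall>\<rho><D. \<forall>\<sigma><D. F \<mu> \<nu> \<rho> \<sigma>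
     = (\<Sum>\<alpha>s \<in> multi_indices D (D - 4). levi_civita D (\<alpha>s @ [\<mu>, \<nu>, \<rho>, \<sigma>]) * c \<alpha>s)"
proof -
  define q where "q \<alpha>s = sorted_list_of_set ({..<D} - set \<alpha>s)" for \<alpha>s
  \<comment> \<open>Using a single ordering of each multi-index avoids dividing by the factorial of
    \<open>D - 4\<close>. The epsilon in front is its own inverse and cancels against the one in the
    sum.\<close>
  define c where "c \<alpha>s = (if sorted \<alpha>s \<and> distinct \<alpha>s
    then levi_civita D (\<alpha>s @ q \<alpha>s) * F (q \<alpha>s ! 0) (q \<alpha>s ! 1) (q \<alpha>s ! 2) (q \<alpha>s ! 3) else 0)" for \<alpha>s
  have fin: "finite (multi_indices D (D - 4))"
    unfolding multi_indices_def using finite_lists_length_eq[of "{..<D}" "D - 4"]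
    by (simp add: conj_commute)
  have "F \<mu> \<nu> \<rho> \<sigma> = (\<Sum>\<alpha>s \<in> multi_indices D (D - 4). levi_civita D (\<alpha>s @ [\<mu>, \<nu>, \<rho>, \<sigma>]) * c \<alpha>s)"
    if lt: "\<mu> < D" "\<nu> < D" "\<rho> < D" "\<sigma> < D" for \<mu> \<nu> \<rho> \<sigma>
  proof (cases "distinct [\<mu>, \<nu>, \<rho>, \<sigma>]")
    case False
    then have "levi_civita D (\<alpha>s @ [\<mu>, \<nu>, \<rho>, \<sigma>]) = 0" for \<alpha>s unfolding levi_civita_def by auto
    moreover have "F \<mu> \<nu> \<rho> \<sigma> = 0" using False antisym4_zero[of F, OF s1 s2 s3] by auto
    ultimately show ?thesis by simp
  next
    case True
    let ?S = "{\<mu>, \<nu>, \<rho>, \<sigma>}"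
    define \<alpha> where "\<alpha> = sorted_list_of_set ({..<D} - ?S)"
    have S: "?S \<subseteq> {..<D}" "card ?S = 4" using lt True by auto
    have \<alpha>: "sorted \<alpha>" "distinct \<alpha>" "set \<alpha> = {..<D} - ?S" by (simp_all add: \<alpha>_def)
    have len: "length \<alpha> = D - 4" unfolding \<alpha>_def using S by (simp add: card_Diff_subset)
    have mem: "\<alpha> \<in> multi_indices D (D - 4)" using \<alpha> len by (auto simp: multi_indices_def)
    \<comment> \<open>A nonzero symbol forces \<open>\<beta>\<close> to enumerate the complement of
      the quadruple, and being sorted fixes its order.\<close>
    have uniq: "\<beta> = \<alpha>" if "\<beta> \<in> multi_indices D (D - 4)" and
      nz: "levi_civita D (\<beta> @ [\<mu>, \<nu>, \<rho>, \<sigma>]) * c \<beta> \<noteq> 0" for \<beta>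
    proof -
      have \<beta>: "sorted \<beta>" "distinct \<beta>" using nz by (auto simp: c_def split: if_splits)
      have d: "distinct (\<beta> @ [\<mu>, \<nu>, \<rho>, \<sigma>])" "set (\<beta> @ [\<mu>, \<nu>, \<rho>, \<sigma>]) \<subseteq> {..<D}"
        and l: "length (\<beta> @ [\<mu>, \<nu>, \<rho>, \<sigma>]) = D"
        using nz unfolding levi_civita_def by (auto split: if_splits)
      have "set (\<beta> @ [\<mu>, \<nu>, \<rho>, \<sigma>]) = {..<D}"
        by (rule card_subset_eq) (use d(2) distinct_card[OF d(1)] l in auto)
      then have "set \<beta> = {..<D} - ?S" using d by auto
      then show ?thesis unfolding \<alpha>_def using \<beta> sorted_list_of_set.idem_if_sorted_distinct by metis
    qed
    have "(\<Sum>\<alpha>s \<in> multi_indices D (D - 4). levi_civita D (\<alpha>s @ [\<mu>, \<nu>, \<rho>, \<sigma>]) * c \<alpha>s)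
       = (\<Sum>\<alpha>s \<in> {\<alpha>}. levi_civita D (\<alpha>s @ [\<mu>, \<nu>, \<rho>, \<sigma>]) * c \<alpha>s)"
    proof (rule sum.mono_neutral_right[OF fin])
      show "{\<alpha>} \<subseteq> multi_indices D (D - 4)" using mem by simp
      show "\<forall>\<beta>\<in>multi_indices D (D - 4) - {\<alpha>}. levi_civita D (\<beta> @ [\<mu>, \<nu>, \<rho>, \<sigma>]) * c \<beta> = 0"
        using uniq by blast
    qed
    also have "\<dots> = levi_civita D (\<alpha> @ [\<mu>, \<nu>, \<rho>, \<sigma>]) * c \<alpha>" by simp
    also have "\<dots> = F \<mu> \<nu> \<rho> \<sigma>"
    proof -
      define L where "L i j k l = levi_civita D (\<alpha> @ [i, j, k, l])" for i j k l
      have s: "L b a c d = - L a b c d" "L a c b d = - L a b c d" "L a b d c = - L a b c d" for a b c d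
        unfolding L_def by (rule levi_civita_swap4)+
      have "{..<D} - set \<alpha> = ?S" using \<alpha>(3) S(1) by auto
      then have "q \<alpha> = sorted_list_of_set ?S" by (simp only: q_def)
      then have q: "distinct (q \<alpha>)" "set (q \<alpha>) = ?S" "length (q \<alpha>) = 4"
        using S(2) by (simp_all only: distinct_sorted_list_of_set set_sorted_list_of_set
            sorted_list_of_set.length_sorted_key_list_of_set finite.intros)
      then obtain w x y z where wxyz: "q \<alpha> = [w, x, y, z]"
        by (auto simp: length_Suc_conv numeral_eq_Suc)
      \<comment> \<open>Both factors change by the sign of the same permutation, so the product is
        the same for the sorted quadruple as for the given one.\<close>
      have "L w x y z * F w x y z = L \<mu> \<nu> \<rho> \<sigma> * F \<mu> \<nu> \<rho> \<sigma>"
      proof -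
        note p = antisym4_perms[where L = L and a = \<mu> and b = \<nu> and c = \<rho> and d = \<sigma>, OF s]
          antisym4_perms[where L = F and a = \<mu> and b = \<nu> and c = \<rho> and d = \<sigma>, OF s1 s2 s3]
        have "w \<in> ?S" "x \<in> ?S" "y \<in> ?S" "z \<in> ?S" and d: "distinct [w, x, y, z]" using q wxyz by auto
        then show ?thesis by (elim insertE emptyE) (simp_all add: p)
      qed
      moreover have "c \<alpha> = L w x y z * F w x y z" using \<alpha> wxyz by (simp add: c_def L_def)
      ultimately have "c \<alpha> = L \<mu> \<nu> \<rho> \<sigma> * F \<mu> \<nu> \<rho> \<sigma>" by (rule trans[rotated])
      then have "L \<mu> \<nu> \<rho> \<sigma> * c \<alpha> = (L \<mu> \<nu> \<rho> \<sigma> * L \<mu> \<nu> \<rho> \<sigma>) * F \<mu> \<nu> \<rho> \<sigma>"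
        by (simp only: mult.assoc)
      also have "L \<mu> \<nu> \<rho> \<sigma> * L \<mu> \<nu> \<rho> \<sigma> = 1" unfolding L_def
      proof (rule levi_civita_square)
        show "length (\<alpha> @ [\<mu>, \<nu>, \<rho>, \<sigma>]) = D" using len D by simp
        show "distinct (\<alpha> @ [\<mu>, \<nu>, \<rho>, \<sigma>])" using \<alpha>(2,3) True by simp
        show "set (\<alpha> @ [\<mu>, \<nu>, \<rho>, \<sigma>]) \<subseteq> {..<D}" using \<alpha>(3) lt by auto
      qed
      finally have "L \<mu> \<nu> \<rho> \<sigma> * c \<alpha> = F \<mu> \<nu> \<rho> \<sigma>" by simp
      then show ?thesis unfolding L_def .
    qed
    finally show ?thesis by simp
  qed
  then show ?thesis by blast
qed

section \<open>Families of bivectors with antisymmetric wedge products\<close>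

lemma fresh_index:
  assumes "finite F" "card F < D"
  shows "\<exists>x<D. x \<notin> (F :: nat set)"
proof (rule ccontr)
  assume "\<not> ?thesis"
  then have "{..<D} \<subseteq> F" by auto
  then have "D \<le> card F" using card_mono[OF assms(1)] by (metis card_lessThan)
  then show False using assms(2) by simp
qed

lemma sum2_delta:
  fixes G :: "nat \<Rightarrow> nat \<Rightarrow> real"
  assumes "a < D" "b < D"
  shows "(\<Sum>\<mu><D. \<Sum>\<nu><D. G \<mu> \<nu> * (if \<mu> = a \<and> \<nu> = b then x else 0)) = x * G a b"
proof -
  have "(\<Sum>\<nu><D. G \<mu> \<nu> * (if \<mu> = a \<and> \<nu> = b then x else 0))
     = (\<Sum>\<nu><D. if \<nu> = b then (if \<mu> = a then x * G a b else 0) else 0)" for \<mu>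
    by (rule sum.cong) auto
  then show ?thesis using assms by simp
qed

lemma divides_form_zero: "divides_form e (\<lambda>i j. 0)"
  unfolding divides_form_def by (rule exI[of _ "\<lambda>i. 0"]) (simp add: wedge11_def)

lemma divides_form_uminus:
  assumes "divides_form e \<phi>"
  shows "divides_form e (\<lambda>i j. - \<phi> i j)"
proof -
  obtain h where "\<phi> = wedge11 e h" using assms by (auto simp: divides_form_def)
  then have "(\<lambda>i j. - \<phi> i j) = wedge11 e (\<lambda>i. - h i)" by (simp add: wedge11_def fun_eq_iff)
  then show ?thesis by (auto simp: divides_form_def)
qed

text \<open>If all products over the perfect matchings of a quadruple agree, then \<open>b 0 \<mu> * b 0 \<nu> / b \<mu> \<nu>\<close>
  does not depend on \<open>\<mu>\<close> and \<open>\<nu>\<close>.\<close>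

lemma exchange_imp_rank_one:
  fixes b :: "nat \<Rightarrow> nat \<Rightarrow> real"
  assumes D: "2 < D"
    and sym: "\<And>\<mu> \<nu>. \<mu> < D \<Longrightarrow> \<nu> < D \<Longrightarrow> \<mu> \<noteq> \<nu> \<Longrightarrow> b \<mu> \<nu> = b \<nu> \<mu>"
    and nz: "\<And>\<mu> \<nu>. \<mu> < D \<Longrightarrow> \<nu> < D \<Longrightarrow> \<mu> \<noteq> \<nu> \<Longrightarrow> b \<mu> \<nu> \<noteq> 0"
    and exch: "\<And>\<mu> \<nu> \<rho> \<sigma>. \<mu> < D \<Longrightarrow> \<nu> < D \<Longrightarrow> \<rho> < D \<Longrightarrow> \<sigma> < D \<Longrightarrow> distinct [\<mu>, \<nu>, \<rho>, \<sigma>]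
       \<Longrightarrow> b \<mu> \<nu> * b \<rho> \<sigma> = b \<mu> \<rho> * b \<nu> \<sigma>"
  shows "\<exists>r s. (s = 1 \<or> s = - 1) \<and> (\<forall>\<mu><D. \<forall>\<nu><D. \<mu> \<noteq> \<nu> \<longrightarrow> b \<mu> \<nu> = s * r \<mu> * r \<nu>)"
proof -
  define K where "K \<mu> \<nu> = b 0 \<mu> * b 0 \<nu> / b \<mu> \<nu>" for \<mu> \<nu>
  have Ksym: "K \<mu> \<nu> = K \<nu> \<mu>" if "\<mu> < D" "\<nu> < D" "\<mu> \<noteq> \<nu>" for \<mu> \<nu>
    using sym[OF that] by (simp add: K_def mult.commute)
  have K: "K \<mu> \<nu> = K \<mu> \<rho>" if h: "\<mu> < D" "\<nu> < D" "\<rho> < D" "0 < \<mu>" "0 < \<nu>" "0 < \<rho>" "\<mu> \<noteq> \<nu>" "\<mu> \<noteq> \<rho>" for \<mu> \<nu> \<rho>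
  proof (cases "\<nu> = \<rho>")
    case False
    have "b 0 \<nu> * b \<rho> \<mu> = b 0 \<rho> * b \<nu> \<mu>" using exch[of 0 \<nu> \<rho> \<mu>] h False D by simp
    then have "b 0 \<nu> * b \<mu> \<rho> = b 0 \<rho> * b \<mu> \<nu>" using sym[of \<mu> \<rho>] sym[of \<mu> \<nu>] h by simp
    then show ?thesis using nz[of \<mu> \<nu>] nz[of \<mu> \<rho>] h by (simp add: K_def field_simps)
  qed simp
  have K12: "K \<mu> \<nu> = K 1 2" if h: "\<mu> < D" "\<nu> < D" "0 < \<mu>" "0 < \<nu>" "\<mu> \<noteq> \<nu>" for \<mu> \<nu>
  proof -
    have one: "K 1 \<nu> = K 1 2" if "\<nu> < D" "0 < \<nu>" "\<nu> \<noteq> 1" for \<nu>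
      by (rule K) (use that D in auto)
    show ?thesis
    proof (cases "\<mu> = 1")
      case True
      then show ?thesis using one[of \<nu>] h by simp
    next
      case False
      have "K \<mu> \<nu> = K \<mu> 1" by (rule K) (use h D False in auto)
      then show ?thesis using Ksym[of \<mu> 1] one[of \<mu>] h False D by simp
    qed
  qed
  have K0: "K 1 2 \<noteq> 0" using nz D by (simp add: K_def)
  \<comment> \<open>In a solution \<open>K 1 2\<close> must equal \<open>s * r 0 * r 0\<close>.
    Hence \<open>s\<close> is its sign, \<open>l\<close> is a choice of \<open>r 0\<close>, and
    \<open>b 0 \<mu> = s * l * r \<mu>\<close> determines the remaining values.\<close>
  define s where "s = sgn (K 1 2)"
  define l where "l = sqrt \<bar>K 1 2\<bar>"
  define r where "r \<mu> = (if \<mu> = 0 then l else s * b 0 \<mu> / l)" for \<mu>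
  have s: "s = 1 \<or> s = - 1" using K0 by (auto simp: s_def sgn_if)
  then have ss: "s * s = 1" by auto
  have l0: "l \<noteq> 0" using K0 by (simp add: l_def)
  have ll: "l * l = s * K 1 2" by (simp add: l_def s_def sgn_if abs_if)
  have "b \<mu> \<nu> = s * r \<mu> * r \<nu>" if h: "\<mu> < D" "\<nu> < D" "\<mu> \<noteq> \<nu>" for \<mu> \<nu>
  proof -
    consider "\<mu> = 0" | "\<nu> = 0" | "0 < \<mu>" "0 < \<nu>" by linarith
    then show ?thesis
    proof cases
      case 1
      have "s * r \<mu> * r \<nu> = (s * s) * b 0 \<nu>" using 1 h l0 by (simp add: r_def)
      then show ?thesis using 1 ss by simp
    next
      case 2
      have "s * r \<mu> * r \<nu> = (s * s) * b 0 \<mu>" using 2 h l0 by (simp add: r_def)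
      then show ?thesis using 2 ss sym[of \<mu> 0] h by simp
    next
      case 3
      have "s * r \<mu> * r \<nu> = (s * s) * s * (b 0 \<mu> * b 0 \<nu>) / (l * l)" using 3 by (simp add: r_def)
      also have "\<dots> = s * (b 0 \<mu> * b 0 \<nu>) / (s * K \<mu> \<nu>)" using K12[OF h(1,2) 3 h(3)] ss ll by simp
      also have "\<dots> = (b 0 \<mu> * b 0 \<nu>) / K \<mu> \<nu>" using s by auto
      also have "\<dots> = b \<mu> \<nu>" using nz[of 0 \<mu>] nz[of 0 \<nu>] nz[of \<mu> \<nu>] h 3 by (simp add: K_def)
      finally show ?thesis by simp
    qed
  qed
  then show ?thesis using s by blast
qed

text \<open>The lower index type is arbitrary, so genericity is replaced by two consequences.
  \<open>independent\<close> says that the kernel contains only symmetric coefficient arrays;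
  \<open>no_common_factor\<close> excludes families divisible by one vector, whose wedge products
  all vanish. Together with \<open>anti_upper\<close>, the exchange of the middle indices in
  \<open>wedge_swap\<close> yields total antisymmetry.\<close>

locale null_bivectors =
  fixes D :: nat and B :: "nat \<Rightarrow> nat \<Rightarrow> 'i \<Rightarrow> 'i \<Rightarrow> real"
  assumes dim: "4 < D"
    and anti_upper: "\<mu> < D \<Longrightarrow> \<nu> < D \<Longrightarrow> B \<nu> \<mu> = (\<lambda>i j. - B \<mu> \<nu> i j)"
    and anti_lower: "\<mu> < D \<Longrightarrow> \<nu> < D \<Longrightarrow> B \<mu> \<nu> j i = - B \<mu> \<nu> i j"
    and independent: "(\<And>i j. (\<Sum>\<mu><D. \<Sum>\<nu><D. B \<mu> \<nu> i j * \<theta> \<mu> \<nu>) = 0) \<Longrightarrow> \<mu> < D \<Longrightarrow> \<nu> < D \<Longrightarrow> \<theta> \<mu> \<nu> = \<theta> \<nu> \<mu>"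
    and no_common_factor: "\<not> (\<forall>\<mu><D. \<forall>\<nu><D. divides_form e (B \<mu> \<nu>))"
    and wedge_swap: "\<mu> < D \<Longrightarrow> \<nu> < D \<Longrightarrow> \<rho> < D \<Longrightarrow> \<sigma> < D \<Longrightarrow>
       wedge22 (B \<mu> \<nu>) (B \<rho> \<sigma>) = (\<lambda>i j k l. - wedge22 (B \<mu> \<rho>) (B \<nu> \<sigma>) i j k l)"
begin

section \<open>Common lines and weights of an antisymmetric family\<close>

lemma diag_zero: "\<mu> < D \<Longrightarrow> B \<mu> \<mu> = (\<lambda>i j. 0)"
  using anti_upper[of \<mu> \<mu>] by (force simp: fun_eq_iff)

text \<open>With equal middle indices \<open>wedge_swap\<close> equates a product with its own
  negative; \<open>anti_upper\<close> moves any shared index into the middle.\<close>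

lemma null:
  assumes "\<mu> < D" "\<nu> < D" "\<rho> < D" "\<sigma> < D" and "\<mu> = \<rho> \<or> \<mu> = \<sigma> \<or> \<nu> = \<rho> \<or> \<nu> = \<sigma>"
  shows "wedge22 (B \<mu> \<nu>) (B \<rho> \<sigma>) = (\<lambda>i j k l. 0)"
proof -
  have n: "wedge22 (B \<mu> \<nu>) (B \<nu> \<sigma>) i j k l = 0" if "\<mu> < D" "\<nu> < D" "\<sigma> < D" for \<mu> \<nu> \<sigma> i j k l
    using fun_cong[OF fun_cong[OF fun_cong[OF fun_cong[OF wedge_swap[of \<mu> \<nu> \<nu> \<sigma>], of i], of j], of k], of l] that
    by simp
  have neg: "wedge22 (\<lambda>i j. - \<phi> i j) \<psi> i j k l = - wedge22 \<phi> \<psi> i j k l"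
    "wedge22 \<phi> (\<lambda>i j. - \<psi> i j) i j k l = - wedge22 \<phi> \<psi> i j k l"
    for \<phi> \<psi> :: "'i \<Rightarrow> 'i \<Rightarrow> real" and i j k l
    by (simp_all add: wedge22_def)
  have "wedge22 (B \<mu> \<nu>) (B \<rho> \<sigma>) i j k l = 0" for i j k l
    using assms(5) n[OF assms(2,1,4), of i j k l] n[OF assms(2,1,3), of i j k l]
      n[OF assms(1,2,4), of i j k l] n[OF assms(1,2,3), of i j k l]
      anti_upper[OF assms(1,2)] anti_upper[OF assms(3,4)]
    by (auto simp: neg)
  then show ?thesis by blast
qed

lemma simple: "\<mu> < D \<Longrightarrow> \<nu> < D \<Longrightarrow> \<exists>u v. B \<mu> \<nu> = wedge11 u v"
proof (rule simple_form)
  assume "\<mu> < D" "\<nu> < D"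
  then show "B \<mu> \<nu> i j = - B \<mu> \<nu> j i" for i j by (rule anti_lower)
  show "wedge22 (B \<mu> \<nu>) (B \<mu> \<nu>) = (\<lambda>i j k l. 0)" by (rule null) (use \<open>\<mu> < D\<close> \<open>\<nu> < D\<close> in auto)
qed

text \<open>The coefficients are placed on one ordering of each pair. The resulting array must be
  symmetric, but its reversed entries are 0 because the unordered pairs differ.\<close>

lemma independent4:
  assumes "a1 < D" "b1 < D" "a2 < D" "b2 < D" "a3 < D" "b3 < D" "a4 < D" "b4 < D"
    and "a1 \<noteq> b1" "a2 \<noteq> b2" "a3 \<noteq> b3" "a4 \<noteq> b4"
    and "distinct [{a1, b1}, {a2, b2}, {a3, b3}, {a4, b4}]"
  shows "lin_indep4 (B a1 b1) (B a2 b2) (B a3 b3) (B a4 b4)"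
  unfolding lin_indep4_def
proof (intro allI impI)
  fix x y z t
  assume eq: "\<forall>i j. x * B a1 b1 i j + y * B a2 b2 i j + z * B a3 b3 i j + t * B a4 b4 i j = 0"
  define \<theta> where "\<theta> \<mu> \<nu> = (if \<mu> = a1 \<and> \<nu> = b1 then x else 0) + (if \<mu> = a2 \<and> \<nu> = b2 then y else 0)
    + (if \<mu> = a3 \<and> \<nu> = b3 then z else 0) + (if \<mu> = a4 \<and> \<nu> = b4 then t else 0)" for \<mu> \<nu>
  have "(\<Sum>\<mu><D. \<Sum>\<nu><D. B \<mu> \<nu> i j * \<theta> \<mu> \<nu>) = 0" for i j
    unfolding \<theta>_def distrib_left sum.distrib using assms eq by (simp add: sum2_delta)
  then have \<theta>: "\<mu> < D \<Longrightarrow> \<nu> < D \<Longrightarrow> \<theta> \<mu> \<nu> = \<theta> \<nu> \<mu>" for \<mu> \<nu> by (rule independent)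
  have d: "{a1, b1} \<noteq> {a2, b2}" "{a1, b1} \<noteq> {a3, b3}" "{a1, b1} \<noteq> {a4, b4}"
    "{a2, b2} \<noteq> {a3, b3}" "{a2, b2} \<noteq> {a4, b4}" "{a3, b3} \<noteq> {a4, b4}"
    using assms(13) by simp_all
  have ne: "\<not> (p = r \<and> q = u)" "\<not> (q = r \<and> p = u)" "\<not> (r = p \<and> u = q)" "\<not> (u = p \<and> r = q)"
    if "{p, q} \<noteq> {r, u}" for p q r u :: nat
    using that by auto
  note ne' = d[THEN ne(1)] d[THEN ne(2)] d[THEN ne(3)] d[THEN ne(4)]
  show "x = 0 \<and> y = 0 \<and> z = 0 \<and> t = 0"
    using \<theta>[OF assms(1,2)] \<theta>[OF assms(3,4)] \<theta>[OF assms(5,6)] \<theta>[OF assms(7,8)]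
    by (simp add: \<theta>_def ne' assms(9-12) assms(9-12)[symmetric])
qed

lemma nonzero:
  assumes "\<mu> < D" "\<nu> < D" "\<mu> \<noteq> \<nu>"
  shows "B \<mu> \<nu> \<noteq> (\<lambda>i j. 0)"
proof
  assume z: "B \<mu> \<nu> = (\<lambda>i j. 0)"
  define \<theta> :: "nat \<Rightarrow> nat \<Rightarrow> real" where "\<theta> a b = (if a = \<mu> \<and> b = \<nu> then 1 else 0)" for a b
  have "(\<Sum>a<D. \<Sum>b<D. B a b i j * \<theta> a b) = 0" for i j
    unfolding \<theta>_def using assms z by (simp add: sum2_delta)
  from independent[OF this assms(1,2)] show False using assms by (simp add: \<theta>_def)
qed

lemma star_common_factor:
  assumes \<mu>: "\<mu> < D"
  shows "\<exists>e. \<forall>\<nu><D. divides_form e (B \<mu> \<nu>)"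
proof -
  \<comment> \<open>Here \<open>D > 4\<close> enters: four indices different from
    \<open>\<mu>\<close> are needed.\<close>
  obtain a where a: "a < D" "a \<notin> {\<mu>}" using fresh_index[of "{\<mu>}" D] dim by auto
  have "card {\<mu>, a} < D" using dim a by auto
  then obtain b where b: "b < D" "b \<notin> {\<mu>, a}" using fresh_index[of "{\<mu>, a}" D] by auto
  have "card {\<mu>, a, b} < D" using dim a b by auto
  then obtain c where c: "c < D" "c \<notin> {\<mu>, a, b}" using fresh_index[of "{\<mu>, a, b}" D] by auto
  have "card {\<mu>, a, b, c} < D" using dim a b c by auto
  then obtain d where d: "d < D" "d \<notin> {\<mu>, a, b, c}" using fresh_index[of "{\<mu>, a, b, c}" D] by auto
  \<comment> \<open>Keeping \<open>a\<close>, \<open>b\<close>, \<open>c\<close> fixed while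
    \<open>x\<close> varies makes the resulting lines comparable: the line shared by the planes of
    \<open>B \<mu> a\<close> and \<open>B \<mu> b\<close> is unique.\<close>
  have four: "lin_indep4 (B \<mu> a) (B \<mu> b) (B \<mu> c) (B \<mu> x) \<and>
     (\<exists>e. divides_form e (B \<mu> a) \<and> divides_form e (B \<mu> b) \<and> divides_form e (B \<mu> c) \<and> divides_form e (B \<mu> x))"
    if x: "x < D" "x \<notin> {\<mu>, a, b, c}" for x
  proof -
    have i: "lin_indep4 (B \<mu> a) (B \<mu> b) (B \<mu> c) (B \<mu> x)"
      by (rule independent4) (use \<mu> a b c x in \<open>auto simp: doubleton_eq_iff\<close>)
    moreover have "\<exists>e. divides_form e (B \<mu> a) \<and> divides_form e (B \<mu> b) \<and> divides_form e (B \<mu> c) \<and> divides_form e (B \<mu> x)"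
      by (rule four_null_common_factor[OF i]) (use \<mu> a b c x simple null in auto)
    ultimately show ?thesis by blast
  qed
  obtain e where e: "divides_form e (B \<mu> a)" "divides_form e (B \<mu> b)" "divides_form e (B \<mu> c)"
    using four[OF d] by blast
  have "divides_form e (B \<mu> x)" if x: "x < D" for x
  proof (cases "x \<in> {\<mu>, a, b, c}")
    case True
    then show ?thesis using e diag_zero[OF \<mu>] divides_form_zero by auto
  next
    case False
    obtain e' where e': "divides_form e' (B \<mu> a)" "divides_form e' (B \<mu> b)" "divides_form e' (B \<mu> x)"
      using four[OF x False] by blast
    have "lin_indep2 (B \<mu> a) (B \<mu> b)" using four[OF d] lin_indep4D by blast
    then obtain k where "e' = (\<lambda>i. k * e i)"
      using common_factor_unique[OF _ e(1,2) e'(1,2)] by blast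
    then show ?thesis using e'(3) divides_form_scale by metis
  qed
  then show ?thesis by blast
qed

text \<open>Determined only up to a nonzero scalar; \<open>weight\<close> compensates for the
  choice.\<close>

definition factor :: "nat \<Rightarrow> 'i \<Rightarrow> real" where
  "factor \<mu> = (SOME e. \<forall>\<nu><D. divides_form e (B \<mu> \<nu>))"

lemma factor_divides: "\<mu> < D \<Longrightarrow> \<nu> < D \<Longrightarrow> divides_form (factor \<mu>) (B \<mu> \<nu>)"
  unfolding factor_def using someI_ex[OF star_common_factor] by blast

text \<open>If the lines of \<open>\<mu>\<close> and \<open>\<nu>\<close> coincided, this line would
  lie in every plane \<open>B \<rho> \<sigma>\<close> as well, so one vector would divide the whole
  family.\<close>

lemma factor_nonparallel:
  assumes \<mu>: "\<mu> < D" and \<nu>: "\<nu> < D" and "\<mu> \<noteq> \<nu>"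
  shows "wedge11 (factor \<mu>) (factor \<nu>) \<noteq> (\<lambda>i j. 0)"
proof
  assume par: "wedge11 (factor \<mu>) (factor \<nu>) = (\<lambda>i j. 0)"
  have "factor \<mu> \<noteq> (\<lambda>i. 0)"
    using factor_divides[OF \<mu> \<nu>] nonzero[OF assms] by (auto simp: divides_form_def wedge11_def)
  then obtain c where c: "factor \<nu> = (\<lambda>i. c * factor \<mu> i)" using parallel_forms[OF par] by blast
  have d\<nu>: "divides_form (factor \<mu>) (B \<nu> \<sigma>)" if "\<sigma> < D" for \<sigma>
    using factor_divides[OF \<nu> that] unfolding c by (rule divides_form_scale)
  have "divides_form (factor \<mu>) (B \<rho> \<sigma>)" if \<rho>: "\<rho> < D" and \<sigma>: "\<sigma> < D" for \<rho> \<sigma>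
  proof -
    consider "\<rho> = \<mu> \<or> \<rho> = \<nu>" | "\<sigma> = \<mu> \<or> \<sigma> = \<nu>" | "\<rho> = \<sigma>" | "distinct [\<mu>, \<nu>, \<rho>, \<sigma>]"
      using assms(3) by auto
    then show ?thesis
    proof cases
      case 1
      then show ?thesis using d\<nu> factor_divides \<mu> \<sigma> by blast
    next
      case 2
      then have "divides_form (factor \<mu>) (B \<sigma> \<rho>)" using d\<nu> factor_divides \<mu> \<rho> by blast
      then show ?thesis using divides_form_uminus anti_upper[OF \<sigma> \<rho>] by metis
    next
      case 3
      then show ?thesis using diag_zero[OF \<rho>] divides_form_zero by metis
    next
      case 4
      have i: "lin_indep4 (B \<mu> \<rho>) (B \<mu> \<sigma>) (B \<nu> \<rho>) (B \<rho> \<sigma>)"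
        by (rule independent4) (use \<mu> \<nu> \<rho> \<sigma> 4 in \<open>auto simp: doubleton_eq_iff\<close>)
      \<comment> \<open>This is the only pair among the four bivectors without a shared index; its
        product vanishes because of the assumed common line.\<close>
      have n: "wedge22 (B \<mu> \<sigma>) (B \<nu> \<rho>) = (\<lambda>i j k l. 0)"
        by (rule wedge22_common_factor[OF factor_divides[OF \<mu> \<sigma>] d\<nu>[OF \<rho>]])
      have "\<exists>e. divides_form e (B \<mu> \<rho>) \<and> divides_form e (B \<mu> \<sigma>) \<and> divides_form e (B \<nu> \<rho>) \<and> divides_form e (B \<rho> \<sigma>)"
        by (rule four_null_common_factor[OF i]) (use n \<mu> \<nu> \<rho> \<sigma> simple null in auto)
      then obtain e where e: "divides_form e (B \<mu> \<rho>)" "divides_form e (B \<mu> \<sigma>)" "divides_form e (B \<rho> \<sigma>)"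
        by blast
      obtain k where "e = (\<lambda>i. k * factor \<mu> i)"
        using common_factor_unique[OF lin_indep4D(1)[OF i] factor_divides[OF \<mu> \<rho>] factor_divides[OF \<mu> \<sigma>] e(1,2)] by blast
      then show ?thesis using e(3) divides_form_scale by metis
    qed
  qed
  then show False using no_common_factor by blast
qed

text \<open>On the diagonal both sides vanish and every scalar qualifies, which is why the facts
  about weights concern distinct indices.\<close>

definition weight :: "nat \<Rightarrow> nat \<Rightarrow> real" where
  "weight \<mu> \<nu> = (SOME c. B \<mu> \<nu> = (\<lambda>i j. c * wedge11 (factor \<mu>) (factor \<nu>) i j))"

lemma B_eq_weight:
  assumes \<mu>: "\<mu> < D" and \<nu>: "\<nu> < D" and "\<mu> \<noteq> \<nu>"
  shows "B \<mu> \<nu> = (\<lambda>i j. weight \<mu> \<nu> * wedge11 (factor \<mu>) (factor \<nu>) i j)"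
proof -
  obtain x y where xy: "wedge11 (factor \<mu>) (factor \<nu>) x y \<noteq> 0"
    using factor_nonparallel[OF assms] by (auto simp: fun_eq_iff)
  have "divides_form (factor \<nu>) (B \<mu> \<nu>)"
    using divides_form_uminus[OF factor_divides[OF \<nu> \<mu>]] anti_upper[OF \<nu> \<mu>] by metis
  from two_factors[OF factor_divides[OF \<mu> \<nu>] this xy] show ?thesis
    unfolding weight_def by (rule someI_ex)
qed

lemma weight_nonzero:
  assumes "\<mu> < D" "\<nu> < D" "\<mu> \<noteq> \<nu>"
  shows "weight \<mu> \<nu> \<noteq> 0"
  using B_eq_weight[OF assms] nonzero[OF assms] by auto

lemma weight_sym:
  assumes "\<mu> < D" "\<nu> < D" "\<mu> \<noteq> \<nu>"
  shows "weight \<mu> \<nu> = weight \<nu> \<mu>"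
proof -
  obtain x y where xy: "wedge11 (factor \<mu>) (factor \<nu>) x y \<noteq> 0"
    using factor_nonparallel[OF assms] by (auto simp: fun_eq_iff)
  have "B \<nu> \<mu> x y = - B \<mu> \<nu> x y" using anti_upper[OF assms(1,2)] by simp
  then have "weight \<nu> \<mu> * wedge11 (factor \<nu>) (factor \<mu>) x y = - (weight \<mu> \<nu> * wedge11 (factor \<mu>) (factor \<nu>) x y)"
    using B_eq_weight[OF assms] B_eq_weight[OF assms(2,1)] assms(3) by simp
  moreover have "wedge11 (factor \<nu>) (factor \<mu>) x y = - wedge11 (factor \<mu>) (factor \<nu>) x y" by (simp add: wedge11_def)
  ultimately show ?thesis using xy by simp
qed

text \<open>A linear relation among the four factors, wedged with \<open>factor \<mu>\<close>,
  becomes one among \<open>B \<mu> \<nu>\<close>, \<open>B \<mu> \<rho>\<close> and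
  \<open>B \<mu> \<sigma>\<close>.\<close>

lemma factor_independent:
  assumes lt: "\<mu> < D" "\<nu> < D" "\<rho> < D" "\<sigma> < D" and dist: "distinct [\<mu>, \<nu>, \<rho>, \<sigma>]"
  shows "wedge22 (wedge11 (factor \<mu>) (factor \<nu>)) (wedge11 (factor \<rho>) (factor \<sigma>)) \<noteq> (\<lambda>i j k l. 0)"
proof
  assume z: "wedge22 (wedge11 (factor \<mu>) (factor \<nu>)) (wedge11 (factor \<rho>) (factor \<sigma>)) = (\<lambda>i j k l. 0)"
  have "lin_indep4 (B \<mu> \<nu>) (B \<mu> \<rho>) (B \<mu> \<sigma>) (B \<nu> \<rho>)"
    by (rule independent4) (use lt dist in \<open>auto simp: doubleton_eq_iff\<close>)
  then have L: "\<forall>i j. x * B \<mu> \<nu> i j + y * B \<mu> \<rho> i j + z * B \<mu> \<sigma> i j + t * B \<nu> \<rho> i j = 0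
     \<Longrightarrow> x = 0 \<and> y = 0 \<and> z = 0 \<and> t = 0" for x y z t
    unfolding lin_indep4_def by blast
  have W: "wedge11 (factor \<mu>) (factor \<nu>) i j = B \<mu> \<nu> i j / weight \<mu> \<nu>" if "\<mu> < D" "\<nu> < D" "\<mu> \<noteq> \<nu>" for \<mu> \<nu> i j
    using B_eq_weight[OF that] weight_nonzero[OF that] by simp
  obtain x y where "wedge11 (factor \<mu>) (factor \<nu>) x y \<noteq> 0"
    using factor_nonparallel[of \<mu> \<nu>] lt dist by (auto simp: fun_eq_iff)
  from wedge22_eq_0_dependent[OF this z] show False
  proof (elim disjE exE)
    fix \<alpha> \<beta> assume r: "factor \<rho> = (\<lambda>i. \<alpha> * factor \<mu> i + \<beta> * factor \<nu> i)"
    have "wedge11 (factor \<mu>) (factor \<rho>) i j = \<beta> * wedge11 (factor \<mu>) (factor \<nu>) i j" for i j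
      by (simp add: r wedge11_def algebra_simps)
    then have "B \<mu> \<rho> i j / weight \<mu> \<rho> = \<beta> * (B \<mu> \<nu> i j / weight \<mu> \<nu>)" for i j
      using W[of \<mu> \<rho>] W[of \<mu> \<nu>] lt dist by simp
    then show False using L[of "- \<beta> / weight \<mu> \<nu>" "1 / weight \<mu> \<rho>" 0 0] weight_nonzero[of \<mu> \<rho>] lt dist by simp
  next
    fix \<alpha> \<beta> \<gamma> assume r: "factor \<sigma> = (\<lambda>i. \<alpha> * factor \<mu> i + \<beta> * factor \<nu> i + \<gamma> * factor \<rho> i)"
    have "wedge11 (factor \<mu>) (factor \<sigma>) i j = \<beta> * wedge11 (factor \<mu>) (factor \<nu>) i j + \<gamma> * wedge11 (factor \<mu>) (factor \<rho>) i j" for i j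
      by (simp add: r wedge11_def algebra_simps)
    then have "B \<mu> \<sigma> i j / weight \<mu> \<sigma> = \<beta> * (B \<mu> \<nu> i j / weight \<mu> \<nu>) + \<gamma> * (B \<mu> \<rho> i j / weight \<mu> \<rho>)" for i j
      using W[of \<mu> \<rho>] W[of \<mu> \<nu>] W[of \<mu> \<sigma>] lt dist by simp
    then show False
      using L[of "- \<beta> / weight \<mu> \<nu>" "- \<gamma> / weight \<mu> \<rho>" "1 / weight \<mu> \<sigma>" 0] weight_nonzero[of \<mu> \<sigma>] lt dist by simp
  qed
qed

text \<open>Both sides of \<open>wedge_swap\<close> are multiples of one nonzero 4-form. Reordering
  its middle factors gives a sign that cancels the one in \<open>wedge_swap\<close>.\<close>

lemma weight_exchange:
  assumes lt: "\<mu> < D" "\<nu> < D" "\<rho> < D" "\<sigma> < D" and dist: "distinct [\<mu>, \<nu>, \<rho>, \<sigma>]"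
  shows "weight \<mu> \<nu> * weight \<rho> \<sigma> = weight \<mu> \<rho> * weight \<nu> \<sigma>"
proof -
  obtain i j k l where nz: "wedge22 (wedge11 (factor \<mu>) (factor \<nu>)) (wedge11 (factor \<rho>) (factor \<sigma>)) i j k l \<noteq> 0"
    using factor_independent[OF assms] by (auto simp: fun_eq_iff)
  have scale: "wedge22 (\<lambda>i j. p * \<phi> i j) (\<lambda>i j. q * \<psi> i j) i j k l = p * q * wedge22 \<phi> \<psi> i j k l"
    for p q :: real and \<phi> \<psi> :: "'i \<Rightarrow> 'i \<Rightarrow> real"
    by (simp add: wedge22_def algebra_simps)
  have "wedge22 (B \<mu> \<nu>) (B \<rho> \<sigma>) i j k l = - wedge22 (B \<mu> \<rho>) (B \<nu> \<sigma>) i j k l"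
    using wedge_swap[OF lt] by simp
  then have "weight \<mu> \<nu> * weight \<rho> \<sigma> * wedge22 (wedge11 (factor \<mu>) (factor \<nu>)) (wedge11 (factor \<rho>) (factor \<sigma>)) i j k l
    = - (weight \<mu> \<rho> * weight \<nu> \<sigma> * wedge22 (wedge11 (factor \<mu>) (factor \<rho>)) (wedge11 (factor \<nu>) (factor \<sigma>)) i j k l)"
    using B_eq_weight[of \<mu> \<nu>] B_eq_weight[of \<rho> \<sigma>] B_eq_weight[of \<mu> \<rho>] B_eq_weight[of \<nu> \<sigma>] lt dist by (simp add: scale)
  moreover have "wedge22 (wedge11 (factor \<mu>) (factor \<rho>)) (wedge11 (factor \<nu>) (factor \<sigma>)) i j k l
     = - wedge22 (wedge11 (factor \<mu>) (factor \<nu>)) (wedge11 (factor \<rho>) (factor \<sigma>)) i j k l"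
    by (simp add: wedge11_def wedge22_def algebra_simps)
  ultimately show ?thesis using nz by simp
qed

lemma frame_exists:
  "\<exists>f s. (s = 1 \<or> s = - 1) \<and> (\<forall>\<mu><D. \<forall>\<nu><D. B \<mu> \<nu> = (\<lambda>i j. s * wedge11 (f \<mu>) (f \<nu>) i j))"
proof -
  have "\<exists>r s. (s = 1 \<or> s = - 1) \<and> (\<forall>\<mu><D. \<forall>\<nu><D. \<mu> \<noteq> \<nu> \<longrightarrow> weight \<mu> \<nu> = s * r \<mu> * r \<nu>)"
    by (rule exchange_imp_rank_one)
      (use dim in simp, (rule weight_sym weight_nonzero weight_exchange; assumption)+)
  then obtain r s where s: "s = 1 \<or> s = - 1"
    and r: "\<And>\<mu> \<nu>. \<mu> < D \<Longrightarrow> \<nu> < D \<Longrightarrow> \<mu> \<noteq> \<nu> \<Longrightarrow> weight \<mu> \<nu> = s * r \<mu> * r \<nu>"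
    by blast
  have "B \<mu> \<nu> = (\<lambda>i j. s * wedge11 (\<lambda>i. r \<mu> * factor \<mu> i) (\<lambda>i. r \<nu> * factor \<nu> i) i j)" if "\<mu> < D" "\<nu> < D" for \<mu> \<nu>
  proof (cases "\<mu> = \<nu>")
    case True
    then show ?thesis using diag_zero that by (simp add: wedge11_def)
  next
    case False
    then show ?thesis using B_eq_weight[OF that False] r[OF that False]
      by (simp add: wedge11_def fun_eq_iff algebra_simps)
  qed
  then show ?thesis using s by (intro exI[of _ "\<lambda>\<mu> i. r \<mu> * factor \<mu> i"] exI[of _ s]) blast
qed

end

section \<open>From bivectors to frames\<close>

lemma det_nat_eq_det: "det_nat D f = det (mat D D (\<lambda>(i, j). f i j))"
proof -
  have "det (mat D D (\<lambda>(i, j). f i j))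
     = (\<Sum>p | p permutes {0..<D}. signof p * (\<Prod>i = 0..<D. mat D D (\<lambda>(i, j). f i j) $$ (i, p i)))"
    by (simp add: det_def)
  also have "\<dots> = (\<Sum>p | p permutes {0..<D}. signof p * (\<Prod>i = 0..<D. f i (p i)))"
    by (intro sum.cong refl arg_cong2[where f = times] prod.cong) (auto dest: permutes_in_image)
  finally show ?thesis by (simp add: det_nat_def lessThan_atLeast0)
qed

text \<open>A kernel vector of a matrix relates its columns, whereas the frame vectors are the rows;
  hence the transpose.\<close>

lemma det_nat_eq_0_imp_row_relation:
  assumes "det_nat D f = 0"
  shows "\<exists>c. (\<exists>\<mu><D. c \<mu> \<noteq> 0) \<and> (\<forall>i<D. (\<Sum>\<mu><D. c \<mu> * f \<mu> i) = 0)"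
proof -
  let ?A = "mat D D (\<lambda>(i, j). f i j)"
  have "det (transpose_mat ?A) = 0" using assms by (simp add: det_nat_eq_det det_transpose[of _ D])
  then obtain v where v: "v \<in> carrier_vec D" "v \<noteq> 0\<^sub>v D" "transpose_mat ?A *\<^sub>v v = 0\<^sub>v D"
    using det_0_iff_vec_prod_zero_field[of "transpose_mat ?A" D] by auto
  have "\<exists>\<mu><D. v $ \<mu> \<noteq> 0" using v(1,2) by (auto intro: eq_vecI)
  moreover have "(\<Sum>\<mu><D. v $ \<mu> * f \<mu> i) = 0" if i: "i < D" for i
  proof -
    have "(transpose_mat ?A *\<^sub>v v) $ i = (\<Sum>\<mu><D. v $ \<mu> * f \<mu> i)"
      using i v(1) by (auto simp: scalar_prod_def lessThan_atLeast0 mult.commute intro!: sum.cong)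
    then show ?thesis using v(3) i by simp
  qed
  ultimately show ?thesis by (intro exI[of _ "\<lambda>\<mu>. v $ \<mu>"]) blast
qed

lemma det_nat_scale: "det_nat D (\<lambda>\<mu> i. t * f \<mu> i) = t ^ D * det_nat D f"
  by (simp add: det_nat_def prod.distrib sum_distrib_left mult.left_commute)

section \<open>Condition (1) in components\<close>

lemma wedge22_antisym:
  assumes \<phi>: "\<And>i j. \<phi> j i = - \<phi> i j" and \<psi>: "\<And>i j. \<psi> j i = - \<psi> i j"
  shows "wedge22 \<phi> \<psi> j i k l = - wedge22 \<phi> \<psi> i j k l"
    and "wedge22 \<phi> \<psi> i k j l = - wedge22 \<phi> \<psi> i j k l"
    and "wedge22 \<phi> \<psi> i j l k = - wedge22 \<phi> \<psi> i j k l"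
  using \<phi>[of i j] \<phi>[of j k] \<phi>[of k l] \<psi>[of i j] \<psi>[of j k] \<psi>[of k l]
  by (simp_all add: wedge22_def)

text \<open>Condition (1) yields components with distinct lower indices only; this covers the
  others, so that equality of whole forms follows.\<close>

lemma wedge22_degenerate:
  fixes \<phi> \<psi> :: "'i \<Rightarrow> 'i \<Rightarrow> real"
  assumes "\<And>i j. \<phi> j i = - \<phi> i j" and "\<And>i j. \<psi> j i = - \<psi> i j" and "\<not> distinct [a, b, c, d]"
  shows "wedge22 \<phi> \<psi> a b c d = 0"
proof -
  note z = antisym4_zero[of "wedge22 \<phi> \<psi>", OF wedge22_antisym[of \<phi> \<psi>, OF assms(1,2)]]
  show ?thesis using assms(3) z by auto
qed

text \<open>Choosing this \<open>ms\<close> in condition (1) isolates the component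
  \<open>a b c d\<close> of the wedge product.\<close>

lemma complement_multi_index:
  assumes "a < D" "b < D" "c < D" "d < D" and "distinct [a, b, c, d]"
  obtains ms where "ms \<in> multi_indices D (D - 4)" "distinct (ms @ [a, b, c, d])" "set (ms @ [a, b, c, d]) = {..<D}"
proof
  let ?S = "{a, b, c, d}"
  define ms where "ms = sorted_list_of_set ({..<D} - ?S)"
  have "?S \<subseteq> {..<D}" "card ?S = 4" using assms by auto
  moreover from this have "length ms = D - 4" unfolding ms_def by (simp add: card_Diff_subset)
  moreover have "distinct ms" "set ms = {..<D} - ?S" by (simp_all add: ms_def)
  ultimately show "ms \<in> multi_indices D (D - 4)" "distinct (ms @ [a, b, c, d])" "set (ms @ [a, b, c, d]) = {..<D}"
    using assms(5) by (auto simp: multi_indices_def)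
qed

lemma multi_index_complement:
  assumes "ms \<in> multi_indices D (D - 4)" "distinct ms" "4 \<le> D"
  obtains a b c d where "distinct (ms @ [a, b, c, d])" "set (ms @ [a, b, c, d]) = {..<D}"
proof -
  have ms: "length ms = D - 4" "set ms \<subseteq> {..<D}" using assms(1) by (auto simp: multi_indices_def)
  define q where "q = sorted_list_of_set ({..<D} - set ms)"
  have "length q = 4" unfolding q_def using ms assms distinct_card[OF assms(2)] by (simp add: card_Diff_subset)
  then obtain a b c d where "q = [a, b, c, d]" by (auto simp: length_Suc_conv numeral_eq_Suc)
  moreover have "distinct q" "set q = {..<D} - set ms" by (simp_all add: q_def)
  ultimately have "distinct (ms @ [a, b, c, d])" "set (ms @ [a, b, c, d]) = {..<D}"
    using assms(2) ms(2) by auto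
  then show ?thesis using that by blast
qed

text \<open>The remaining antisymmetries in the upper indices hold for any bivectors or follow from this one.\<close>

lemma epsilon_dual_imp_wedge_swap:
  fixes B :: "nat \<Rightarrow> nat \<Rightarrow> nat \<Rightarrow> nat \<Rightarrow> real"
  assumes anti: "\<And>\<mu> \<nu>. \<mu> < D \<Longrightarrow> \<nu> < D \<Longrightarrow> antisym2 D (B \<mu> \<nu>)"
    and dual: "\<forall>ms \<in> multi_indices D (D - 4). \<forall>\<mu><D. \<forall>\<nu><D. \<forall>\<rho><D. \<forall>\<sigma><D.
              (\<Sum>i<D. \<Sum>j<D. \<Sum>k<D. \<Sum>l<D.
                  levi_civita D (ms @ [i, j, k, l]) * B \<mu> \<nu> i j * B \<rho> \<sigma> k l)
              = (\<Sum>\<alpha>s \<in> multi_indices D (D - 4).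
                  levi_civita D (\<alpha>s @ [\<mu>, \<nu>, \<rho>, \<sigma>]) * c ms \<alpha>s)"
    and lt: "\<mu> < D" "\<nu> < D" "\<rho> < D" "\<sigma> < D"
    and abcd: "a < D" "b < D" "x < D" "d < D" "distinct [a, b, x, d]"
  shows "wedge22 (B \<mu> \<nu>) (B \<rho> \<sigma>) a b x d = - wedge22 (B \<mu> \<rho>) (B \<nu> \<sigma>) a b x d"
proof -
  obtain ms where ms: "ms \<in> multi_indices D (D - 4)" "distinct (ms @ [a, b, x, d])" "set (ms @ [a, b, x, d]) = {..<D}"
    using complement_multi_index[OF abcd] by blast
  let ?l = "levi_civita D (ms @ [a, b, x, d])"
  have W: "4 * ?l * wedge22 (B \<mu> \<nu>) (B \<rho> \<sigma>) a b x d
     = (\<Sum>\<alpha>s \<in> multi_indices D (D - 4). levi_civita D (\<alpha>s @ [\<mu>, \<nu>, \<rho>, \<sigma>]) * c ms \<alpha>s)"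
    if "\<mu> < D" "\<nu> < D" "\<rho> < D" "\<sigma> < D" for \<mu> \<nu> \<rho> \<sigma>
    by (rule trans[OF sym[OF levi_civita_wedge22[OF ms(2,3) anti[OF that(1,2)] anti[OF that(3,4)]]]
          dual[rule_format, OF ms(1) that]])
  have "?l * ?l = 1"
  proof (rule levi_civita_square)
    show "length (ms @ [a, b, x, d]) = D" using distinct_card[OF ms(2)] ms(3) by simp
  qed (use ms in auto)
  then have "?l \<noteq> 0" by auto
  \<comment> \<open>The coefficients \<open>c ms\<close> do not depend on the upper indices, so
    exchanging \<open>\<nu>\<close> and \<open>\<rho>\<close> only changes the sign of the symbol on
    the right.\<close>
  have "4 * ?l * wedge22 (B \<mu> \<nu>) (B \<rho> \<sigma>) a b x d = - (4 * ?l * wedge22 (B \<mu> \<rho>) (B \<nu> \<sigma>) a b x d)"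
    unfolding W[OF lt] W[OF lt(1,3,2,4)] levi_civita_swap4(2)[of D _ \<mu> \<rho> \<nu> \<sigma>]
    by (simp add: sum_negf)
  then have "(4 * ?l) * wedge22 (B \<mu> \<nu>) (B \<rho> \<sigma>) a b x d = (4 * ?l) * - wedge22 (B \<mu> \<rho>) (B \<nu> \<sigma>) a b x d"
    by simp
  moreover have "4 * ?l \<noteq> 0" using \<open>?l \<noteq> 0\<close> by simp
  ultimately show ?thesis by (metis mult_left_cancel)
qed

text \<open>For fixed \<open>ms\<close> the left side is a constant times one component of the wedge
  of four frame vectors, hence totally antisymmetric in the upper indices. The constant is 0 if
  \<open>ms\<close> has a repeated entry.\<close>

lemma frame_imp_epsilon_dual:
  fixes B :: "nat \<Rightarrow> nat \<Rightarrow> nat \<Rightarrow> nat \<Rightarrow> real"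
  assumes D: "4 \<le> D"
    and B: "\<And>\<mu> \<nu> i j. \<mu> < D \<Longrightarrow> \<nu> < D \<Longrightarrow> i < D \<Longrightarrow> j < D \<Longrightarrow> B \<mu> \<nu> i j = r * wedge11 (e \<mu>) (e \<nu>) i j"
  shows "\<exists>c. \<forall>ms \<in> multi_indices D (D - 4). \<forall>\<mu><D. \<forall>\<nu><D. \<forall>\<rho><D. \<forall>\<sigma><D.
              (\<Sum>i<D. \<Sum>j<D. \<Sum>k<D. \<Sum>l<D.
                  levi_civita D (ms @ [i, j, k, l]) * B \<mu> \<nu> i j * B \<rho> \<sigma> k l)
              = (\<Sum>\<alpha>s \<in> multi_indices D (D - 4).
                  levi_civita D (\<alpha>s @ [\<mu>, \<nu>, \<rho>, \<sigma>]) * c ms \<alpha>s)"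
proof (rule bchoice, rule ballI)
  fix ms assume ms: "ms \<in> multi_indices D (D - 4)"
  let ?T = "\<lambda>\<mu> \<nu> \<rho> \<sigma>. \<Sum>i<D. \<Sum>j<D. \<Sum>k<D. \<Sum>l<D. levi_civita D (ms @ [i, j, k, l]) * B \<mu> \<nu> i j * B \<rho> \<sigma> k l"
  have "\<exists>k a b x d. \<forall>\<mu><D. \<forall>\<nu><D. \<forall>\<rho><D. \<forall>\<sigma><D.
     ?T \<mu> \<nu> \<rho> \<sigma> = k * wedge22 (wedge11 (e \<mu>) (e \<nu>)) (wedge11 (e \<rho>) (e \<sigma>)) a b x d"
  proof (cases "distinct ms")
    case False
    then have "levi_civita D (ms @ [i, j, k, l]) = 0" for i j k l by (simp add: levi_civita_def)
    then show ?thesis by (intro exI[of _ 0]) simp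
  next
    case True
    obtain a b x d where abxd: "distinct (ms @ [a, b, x, d])" "set (ms @ [a, b, x, d]) = {..<D}"
      using multi_index_complement[OF ms True D] by blast
    then have lt: "a < D" "b < D" "x < D" "d < D" by auto
    have anti: "antisym2 D (B \<mu> \<nu>)" if "\<mu> < D" "\<nu> < D" for \<mu> \<nu>
      using that by (simp add: antisym2_def B wedge11_def algebra_simps)
    have "?T \<mu> \<nu> \<rho> \<sigma> = (4 * levi_civita D (ms @ [a, b, x, d]) * r * r)
       * wedge22 (wedge11 (e \<mu>) (e \<nu>)) (wedge11 (e \<rho>) (e \<sigma>)) a b x d"
      if "\<mu> < D" "\<nu> < D" "\<rho> < D" "\<sigma> < D" for \<mu> \<nu> \<rho> \<sigma>
      unfolding levi_civita_wedge22[OF abxd anti[OF that(1,2)] anti[OF that(3,4)]]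
      by (simp add: wedge22_def B that lt algebra_simps)
    then show ?thesis by blast
  qed
  then obtain k a b x d where T: "\<And>\<mu> \<nu> \<rho> \<sigma>. \<mu> < D \<Longrightarrow> \<nu> < D \<Longrightarrow> \<rho> < D \<Longrightarrow> \<sigma> < D \<Longrightarrow>
     ?T \<mu> \<nu> \<rho> \<sigma> = k * wedge22 (wedge11 (e \<mu>) (e \<nu>)) (wedge11 (e \<rho>) (e \<sigma>)) a b x d"
    by blast
  \<comment> \<open>The dualisation lemma asks for antisymmetry at all indices, while the
    contraction with \<open>B\<close> is controlled below \<open>D\<close> only. The explicit
    formula is antisymmetric everywhere and agrees with it in range.\<close>
  define F where "F \<mu> \<nu> \<rho> \<sigma> = k * wedge22 (wedge11 (e \<mu>) (e \<nu>)) (wedge11 (e \<rho>) (e \<sigma>)) a b x d" for \<mu> \<nu> \<rho> \<sigma>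
  have F: "F \<nu> \<mu> \<rho> \<sigma> = - F \<mu> \<nu> \<rho> \<sigma>" "F \<mu> \<rho> \<nu> \<sigma> = - F \<mu> \<nu> \<rho> \<sigma>" "F \<mu> \<nu> \<sigma> \<rho> = - F \<mu> \<nu> \<rho> \<sigma>" for \<mu> \<nu> \<rho> \<sigma>
    by (simp_all add: F_def wedge11_def wedge22_def algebra_simps)
  show "\<exists>c. \<forall>\<mu><D. \<forall>\<nu><D. \<forall>\<rho><D. \<forall>\<sigma><D. ?T \<mu> \<nu> \<rho> \<sigma>
     = (\<Sum>\<alpha>s \<in> multi_indices D (D - 4). levi_civita D (\<alpha>s @ [\<mu>, \<nu>, \<rho>, \<sigma>]) * c \<alpha>s)"
    using antisym4_epsilon_dual[OF D F] T unfolding F_def by simp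
qed

lemma wedge_swap_imp_frame:
  fixes B :: "nat \<Rightarrow> nat \<Rightarrow> nat \<Rightarrow> nat \<Rightarrow> real"
  assumes D: "4 < D" and bv: "bivector_array D B" and gen: "generic_B D B"
    and swap: "\<And>\<mu> \<nu> \<rho> \<sigma> a b x d. \<mu> < D \<Longrightarrow> \<nu> < D \<Longrightarrow> \<rho> < D \<Longrightarrow> \<sigma> < D \<Longrightarrow>
      a < D \<Longrightarrow> b < D \<Longrightarrow> x < D \<Longrightarrow> d < D \<Longrightarrow> distinct [a, b, x, d] \<Longrightarrow>
      wedge22 (B \<mu> \<nu>) (B \<rho> \<sigma>) a b x d = - wedge22 (B \<mu> \<rho>) (B \<nu> \<sigma>) a b x d"
  shows "\<exists>f s. (s = 1 \<or> s = - 1) \<and>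
     (\<forall>\<mu><D. \<forall>\<nu><D. \<forall>i<D. \<forall>j<D. B \<mu> \<nu> i j = s * wedge11 (f \<mu>) (f \<nu>) i j)"
proof -
  \<comment> \<open>Extension by zero turns statements about indices below \<open>D\<close> into
    equalities of functions, as the locale requires.\<close>
  define T where "T \<mu> \<nu> i j = (if i < D \<and> j < D then B \<mu> \<nu> i j else 0)" for \<mu> \<nu> i j
  have bv1: "B \<nu> \<mu> i j = - B \<mu> \<nu> i j" and bv2: "B \<mu> \<nu> j i = - B \<mu> \<nu> i j"
    if "\<mu> < D" "\<nu> < D" "i < D" "j < D" for \<mu> \<nu> i j
    using bv that unfolding bivector_array_def by blast+
  have anti: "T \<mu> \<nu> j i = - T \<mu> \<nu> i j" if "\<mu> < D" "\<nu> < D" for \<mu> \<nu> i j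
    using that by (auto simp: T_def intro: bv2)
  interpret null_bivectors D T
  proof
    show "4 < D" by (fact D)
    show "T \<nu> \<mu> = (\<lambda>i j. - T \<mu> \<nu> i j)" if "\<mu> < D" "\<nu> < D" for \<mu> \<nu>
      using that by (auto simp: T_def fun_eq_iff intro: bv1)
    show "T \<mu> \<nu> j i = - T \<mu> \<nu> i j" if "\<mu> < D" "\<nu> < D" for \<mu> \<nu> i j
      by (rule anti[OF that])
    show "\<theta> \<mu> \<nu> = \<theta> \<nu> \<mu>" if z: "\<And>i j. (\<Sum>\<mu><D. \<Sum>\<nu><D. T \<mu> \<nu> i j * \<theta> \<mu> \<nu>) = 0" and lt: "\<mu> < D" "\<nu> < D"
      for \<theta> \<mu> \<nu>
    proof -
      have B0: "(\<Sum>\<mu><D. \<Sum>\<nu><D. B \<mu> \<nu> i j * \<theta> \<mu> \<nu>) = 0" if "i < D" "j < D" for i j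
        using z[of i j] that by (simp add: T_def)
      \<comment> \<open>Genericity speaks of antisymmetric arrays only. If \<open>B\<close>
        annihilates \<open>\<theta>\<close>, it annihilates the transpose too, hence this
        difference.\<close>
      let ?\<eta> = "\<lambda>a b. \<theta> a b - \<theta> b a"
      have "B_map D B ?\<eta> i j = 0" if ij: "i < D" "j < D" for i j
      proof -
        have "(\<Sum>\<mu><D. \<Sum>\<nu><D. B \<mu> \<nu> i j * \<theta> \<nu> \<mu>) = (\<Sum>\<nu><D. \<Sum>\<mu><D. B \<mu> \<nu> i j * \<theta> \<nu> \<mu>)"
          by (rule sum.swap)
        also have "\<dots> = (\<Sum>\<nu><D. \<Sum>\<mu><D. - (B \<nu> \<mu> i j * \<theta> \<nu> \<mu>))"
        proof (intro sum.cong refl)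
          fix \<nu> \<mu> assume "\<nu> \<in> {..<D}" "\<mu> \<in> {..<D}"
          then show "B \<mu> \<nu> i j * \<theta> \<nu> \<mu> = - (B \<nu> \<mu> i j * \<theta> \<nu> \<mu>)" using bv1[of \<nu> \<mu> i j] ij by simp
        qed
        also have "\<dots> = 0" using B0[OF ij] by (simp add: sum_negf)
        finally show ?thesis using B0[OF ij] by (simp add: B_map_def right_diff_distrib sum_subtractf)
      qed
      moreover have "antisym2 D ?\<eta>" by (simp add: antisym2_def)
      ultimately have "?\<eta> \<mu> \<nu> = 0" using gen lt unfolding generic_B_def by blast
      then show ?thesis by simp
    qed
    show "\<not> (\<forall>\<mu><D. \<forall>\<nu><D. divides_form e (T \<mu> \<nu>))" for e
    proof
      assume div: "\<forall>\<mu><D. \<forall>\<nu><D. divides_form e (T \<mu> \<nu>)"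
      have e0: "wedge12 e (T \<mu> \<nu>) i j k = 0" if lt: "\<mu> < D" "\<nu> < D" for \<mu> \<nu> i j k
      proof -
        obtain h where "T \<mu> \<nu> = wedge11 e h" using div lt unfolding divides_form_def by blast
        then show ?thesis by (simp add: wedge11_def wedge12_def algebra_simps)
      qed
      \<comment> \<open>By surjectivity every bivector is a combination of the
        \<open>T \<mu> \<nu>\<close>, so a vector dividing all of these has zero wedge with every
        bivector.\<close>
      have range: "wedge12 e \<phi> i j k = 0" if \<phi>: "antisym2 D \<phi>" and ijk: "i < D" "j < D" "k < D" for \<phi> i j k
      proof -
        obtain \<theta> where \<theta>: "\<forall>i<D. \<forall>j<D. B_map D B \<theta> i j = \<phi> i j"
          using gen \<phi> unfolding generic_B_def by blast
        have BT: "\<phi> i j = (\<Sum>\<mu><D. \<Sum>\<nu><D. T \<mu> \<nu> i j * \<theta> \<mu> \<nu>)" if "i < D" "j < D" for i j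
        proof -
          have "\<phi> i j = B_map D B \<theta> i j" using \<theta> that by simp
          then show ?thesis using that by (simp add: B_map_def T_def)
        qed
        have "wedge12 e \<phi> i j k = (\<Sum>\<mu><D. \<Sum>\<nu><D. wedge12 e (T \<mu> \<nu>) i j k * \<theta> \<mu> \<nu>)"
          unfolding wedge12_def BT[OF ijk(1,2)] BT[OF ijk(2,3)] BT[OF ijk(3,1)] sum_distrib_left
            sum.distrib[symmetric] by (intro sum.cong refl) (simp add: algebra_simps)
        then show ?thesis using e0 by simp
      qed
      \<comment> \<open>Elementary bivectors: for distinct \<open>a\<close>, \<open>b\<close>,
        \<open>c\<close>, the component \<open>a b c\<close> of \<open>e \<and> \<delta> b c\<close>
        is \<open>e a\<close>, so \<open>e\<close> vanishes below \<open>D\<close>.\<close>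
      define \<delta> :: "nat \<Rightarrow> nat \<Rightarrow> nat \<Rightarrow> nat \<Rightarrow> real" where
        "\<delta> b c = wedge11 (\<lambda>i. of_bool (i = b)) (\<lambda>i. of_bool (i = c))" for b c
      have \<delta>: "antisym2 D (\<delta> b c)" for b c
        unfolding antisym2_def \<delta>_def wedge11_def by (simp add: mult.commute)
      have ez: "e a = 0" if a: "a < D" for a
      proof -
        obtain b where b: "b < D" "b \<noteq> a" using fresh_index[of "{a}" D] D by auto
        have "card {a, b} < D" using b D by auto
        then obtain c where c: "c < D" "c \<noteq> a" "c \<noteq> b" using fresh_index[of "{a, b}" D] by auto
        have "\<delta> b c b c = 1" "\<delta> b c c a = 0" "\<delta> b c a b = 0" using b c by (auto simp: \<delta>_def wedge11_def)
        then have "wedge12 e (\<delta> b c) a b c = e a" by (simp add: wedge12_def)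
        then show ?thesis using range[OF \<delta> a b(1) c(1)] by simp
      qed
      have B0: "B \<mu> \<nu> 0 1 = 0" if lt: "\<mu> < D" "\<nu> < D" for \<mu> \<nu>
      proof -
        obtain h where "T \<mu> \<nu> = wedge11 e h" using div lt unfolding divides_form_def by blast
        then have "T \<mu> \<nu> 0 1 = 0" using ez[of 0] ez[of 1] D by (simp add: wedge11_def)
        then show ?thesis using D by (simp add: T_def)
      qed
      obtain \<theta> where "\<forall>i<D. \<forall>j<D. B_map D B \<theta> i j = \<delta> 0 1 i j"
        using gen \<delta> unfolding generic_B_def by blast
      then have "B_map D B \<theta> 0 1 = 1" using D by (simp add: \<delta>_def wedge11_def)
      then show False using B0 by (simp add: B_map_def)
    qed
    show "wedge22 (T \<mu> \<nu>) (T \<rho> \<sigma>) = (\<lambda>i j k l. - wedge22 (T \<mu> \<rho>) (T \<nu> \<sigma>) i j k l)"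
      if lt: "\<mu> < D" "\<nu> < D" "\<rho> < D" "\<sigma> < D" for \<mu> \<nu> \<rho> \<sigma>
    proof (intro ext)
      fix a b x d
      consider "a < D" "b < D" "x < D" "d < D" "distinct [a, b, x, d]" | "\<not> distinct [a, b, x, d]"
        | "\<not> (a < D \<and> b < D \<and> x < D \<and> d < D)" by blast
      then show "wedge22 (T \<mu> \<nu>) (T \<rho> \<sigma>) a b x d = - wedge22 (T \<mu> \<rho>) (T \<nu> \<sigma>) a b x d"
      proof cases
        case 1
        then show ?thesis using swap[OF lt 1] by (simp add: wedge22_def T_def)
      next
        case 2
        have "wedge22 (T \<mu> \<nu>) (T \<rho> \<sigma>) a b x d = 0"
          by (rule wedge22_degenerate[OF anti[OF lt(1,2)] anti[OF lt(3,4)] 2])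
        moreover have "wedge22 (T \<mu> \<rho>) (T \<nu> \<sigma>) a b x d = 0"
          by (rule wedge22_degenerate[OF anti[OF lt(1,3)] anti[OF lt(2,4)] 2])
        ultimately show ?thesis by simp
      next
        case 3
        \<comment> \<open>Every term of the wedge product involves all four indices, so one index
          out of range makes it vanish.\<close>
        then show ?thesis by (auto simp: wedge22_def T_def)
      qed
    qed
  qed
  obtain f s where fs: "s = 1 \<or> s = - 1" "\<forall>\<mu><D. \<forall>\<nu><D. T \<mu> \<nu> = (\<lambda>i j. s * wedge11 (f \<mu>) (f \<nu>) i j)"
    using frame_exists by blast
  have "B \<mu> \<nu> i j = s * wedge11 (f \<mu>) (f \<nu>) i j" if "\<mu> < D" "\<nu> < D" "i < D" "j < D" for \<mu> \<nu> i j
  proof -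
    have "T \<mu> \<nu> i j = s * wedge11 (f \<mu>) (f \<nu>) i j" using fs(2) that by simp
    then show ?thesis using that by (simp add: T_def)
  qed
  then show ?thesis using fs(1) by blast
qed

text \<open>A relation with coefficients \<open>c\<close> among the frame vectors, wedged with
  \<open>f \<nu>\<close>, gives a kernel element of \<open>B\<close>: the antisymmetrisation of
  \<open>c\<close> tensored with the unit vector at \<open>\<nu>\<close>. Since \<open>\<nu>\<close>
  differs from an index \<open>\<mu>\<close> with \<open>c \<mu>\<close> nonzero, its entry at
  \<open>\<mu> \<nu>\<close> is not 0.\<close>

lemma generic_frame_det_nonzero:
  fixes B :: "nat \<Rightarrow> nat \<Rightarrow> nat \<Rightarrow> nat \<Rightarrow> real"
  assumes D: "1 < D" and gen: "generic_B D B"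
    and B: "\<And>\<mu> \<nu> i j. \<mu> < D \<Longrightarrow> \<nu> < D \<Longrightarrow> i < D \<Longrightarrow> j < D \<Longrightarrow> B \<mu> \<nu> i j = s * wedge11 (f \<mu>) (f \<nu>) i j"
  shows "det_nat D f \<noteq> 0"
proof
  assume "det_nat D f = 0"
  then obtain c \<mu> where c: "\<mu> < D" "c \<mu> \<noteq> 0" and rel: "\<And>i. i < D \<Longrightarrow> (\<Sum>\<mu><D. c \<mu> * f \<mu> i) = 0"
    using det_nat_eq_0_imp_row_relation by blast
  obtain \<nu> where \<nu>: "\<nu> < D" "\<nu> \<noteq> \<mu>" using fresh_index[of "{\<mu>}" D] D by auto
  define \<theta> where "\<theta> a b = (if b = \<nu> then c a else 0) - (if a = \<nu> then c b else 0)" for a b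
  have "B_map D B \<theta> i j = 0" if ij: "i < D" "j < D" for i j
  proof -
    have p: "(\<Sum>a<D. B a \<nu> i j * c a) = 0"
    proof -
      have "(\<Sum>a<D. B a \<nu> i j * c a) = (\<Sum>a<D. s * f \<nu> j * (c a * f a i) - s * f \<nu> i * (c a * f a j))"
        by (intro sum.cong refl) (simp add: B ij \<nu> wedge11_def algebra_simps)
      also have "\<dots> = 0" using rel[OF ij(1)] rel[OF ij(2)]
        by (simp add: sum_subtractf flip: sum_distrib_left)
      finally show ?thesis .
    qed
    have q: "(\<Sum>a<D. B \<nu> a i j * c a) = - (\<Sum>a<D. B a \<nu> i j * c a)"
      unfolding sum_negf[symmetric]
      by (intro sum.cong refl) (simp add: B ij \<nu> wedge11_def algebra_simps)
    have "B_map D B \<theta> i j = (\<Sum>a<D. \<Sum>b<D. if b = \<nu> then B a \<nu> i j * c a else 0)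
       - (\<Sum>a<D. \<Sum>b<D. if a = \<nu> then B \<nu> b i j * c b else 0)"
      unfolding B_map_def \<theta>_def sum_subtractf[symmetric]
      by (intro sum.cong refl) (auto simp: algebra_simps)
    also have "(\<Sum>a<D. \<Sum>b<D. if a = \<nu> then B \<nu> b i j * c b else 0) = (\<Sum>b<D. B \<nu> b i j * c b)"
      by (subst sum.swap) (simp add: \<nu>)
    finally show ?thesis using p q \<nu> by simp
  qed
  moreover have "antisym2 D \<theta>" by (simp add: antisym2_def \<theta>_def)
  ultimately have "\<theta> \<mu> \<nu> = 0" using gen c \<nu> unfolding generic_B_def by blast
  then show False using c \<nu> by (simp add: \<theta>_def)
qed

text \<open>Rescaling the frame by \<open>t\<close> multiplies \<open>\<bar>det f\<bar> f \<and> f\<close> by \<open>t ^ (D + 2)\<close>.\<close>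

lemma normalize_frame:
  assumes "det_nat D f \<noteq> 0"
  shows "\<exists>t. \<bar>det_nat D (\<lambda>\<mu> i. t * f \<mu> i)\<bar> * t\<^sup>2 = 2"
proof -
  \<comment> \<open>The numerator 2 cancels the 1/2 of the antisymmetrization bracket.\<close>
  define t where "t = root (D + 2) (2 / \<bar>det_nat D f\<bar>)"
  have "t ^ (D + 2) = 2 / \<bar>det_nat D f\<bar>" "0 \<le> t"
    unfolding t_def by (rule real_root_pow_pos2) simp_all
  then have "\<bar>det_nat D (\<lambda>\<mu> i. t * f \<mu> i)\<bar> * t\<^sup>2 = 2"
    using assms by (simp add: det_nat_scale abs_mult power_add power2_eq_square field_simps)
  then show ?thesis by blast
qed

theorem theorem1:
  fixes D :: nat and B :: "nat \<Rightarrow> nat \<Rightarrow> nat \<Rightarrow> nat \<Rightarrow> real"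
  assumes "D > 4"
    and "bivector_array D B"
    and "generic_B D B"
  shows "(\<exists>c :: nat list \<Rightarrow> nat list \<Rightarrow> real.
            \<forall>ms \<in> multi_indices D (D - 4). \<forall>\<mu><D. \<forall>\<nu><D. \<forall>\<rho><D. \<forall>\<sigma><D.
              (\<Sum>i<D. \<Sum>j<D. \<Sum>k<D. \<Sum>l<D.
                  levi_civita D (ms @ [i, j, k, l]) * B \<mu> \<nu> i j * B \<rho> \<sigma> k l)
              = (\<Sum>\<alpha>s \<in> multi_indices D (D - 4).
                  levi_civita D (\<alpha>s @ [\<mu>, \<nu>, \<rho>, \<sigma>]) * c ms \<alpha>s))
     \<longleftrightarrow>
         (\<exists>e :: nat \<Rightarrow> nat \<Rightarrow> real. \<exists>s :: real. (s = 1 \<or> s = -1) \<and>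
            (\<forall>\<mu><D. \<forall>\<nu><D. \<forall>i<D. \<forall>j<D.
               B \<mu> \<nu> i j = s * \<bar>det_nat D e\<bar> * ((e \<mu> i * e \<nu> j - e \<nu> i * e \<mu> j) / 2)))"
    (is "?dual \<longleftrightarrow> ?frame")
proof
  assume ?dual
  then obtain c where c: "\<forall>ms \<in> multi_indices D (D - 4). \<forall>\<mu><D. \<forall>\<nu><D. \<forall>\<rho><D. \<forall>\<sigma><D.
              (\<Sum>i<D. \<Sum>j<D. \<Sum>k<D. \<Sum>l<D.
                  levi_civita D (ms @ [i, j, k, l]) * B \<mu> \<nu> i j * B \<rho> \<sigma> k l)
              = (\<Sum>\<alpha>s \<in> multi_indices D (D - 4).
                  levi_civita D (\<alpha>s @ [\<mu>, \<nu>, \<rho>, \<sigma>]) * c ms \<alpha>s)" by blast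
  have anti: "antisym2 D (B \<mu> \<nu>)" if "\<mu> < D" "\<nu> < D" for \<mu> \<nu>
    using assms(2) that unfolding bivector_array_def antisym2_def by blast
  have "\<exists>f s. (s = 1 \<or> s = - 1) \<and>
     (\<forall>\<mu><D. \<forall>\<nu><D. \<forall>i<D. \<forall>j<D. B \<mu> \<nu> i j = s * wedge11 (f \<mu>) (f \<nu>) i j)"
    by (rule wedge_swap_imp_frame[OF assms]) (rule epsilon_dual_imp_wedge_swap[OF anti c])
  then obtain f s where s: "s = 1 \<or> s = - 1"
    and f: "\<And>\<mu> \<nu> i j. \<mu> < D \<Longrightarrow> \<nu> < D \<Longrightarrow> i < D \<Longrightarrow> j < D \<Longrightarrow> B \<mu> \<nu> i j = s * wedge11 (f \<mu>) (f \<nu>) i j"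
    by blast
  have "det_nat D f \<noteq> 0"
    by (rule generic_frame_det_nonzero[OF _ assms(3) f]) (use assms(1) in auto)
  then obtain t where t: "\<bar>det_nat D (\<lambda>\<mu> i. t * f \<mu> i)\<bar> * t\<^sup>2 = 2" using normalize_frame by blast
  have "B \<mu> \<nu> i j = s * \<bar>det_nat D (\<lambda>\<mu> i. t * f \<mu> i)\<bar> * ((t * f \<mu> i * (t * f \<nu> j) - t * f \<nu> i * (t * f \<mu> j)) / 2)"
    if "\<mu> < D" "\<nu> < D" "i < D" "j < D" for \<mu> \<nu> i j
  proof -
    let ?d = "\<bar>det_nat D (\<lambda>\<mu> i. t * f \<mu> i)\<bar>"
    have "s * ?d * ((t * f \<mu> i * (t * f \<nu> j) - t * f \<nu> i * (t * f \<mu> j)) / 2)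
       = s * (?d * t\<^sup>2 / 2) * (f \<mu> i * f \<nu> j - f \<nu> i * f \<mu> j)"
      by (simp add: power2_eq_square algebra_simps diff_divide_distrib)
    also have "\<dots> = B \<mu> \<nu> i j" unfolding t f[OF that] wedge11_def by simp
    finally show ?thesis by simp
  qed
  then show ?frame using s by (intro exI[of _ "\<lambda>\<mu> i. t * f \<mu> i"] exI[of _ s]) blast
next
  assume ?frame
  then obtain e s where e: "\<forall>\<mu><D. \<forall>\<nu><D. \<forall>i<D. \<forall>j<D.
     B \<mu> \<nu> i j = s * \<bar>det_nat D e\<bar> * ((e \<mu> i * e \<nu> j - e \<nu> i * e \<mu> j) / 2)" by blast
  show ?dual
  proof (rule frame_imp_epsilon_dual)
    show "4 \<le> D" using assms(1) by simp
    \<comment> \<open>Sign, determinant and the bracket's 1/2 are absorbed into one scalar.\<close>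
    show "B \<mu> \<nu> i j = (s * \<bar>det_nat D e\<bar> / 2) * wedge11 (e \<mu>) (e \<nu>) i j"
      if "\<mu> < D" "\<nu> < D" "i < D" "j < D" for \<mu> \<nu> i j
      using e that by (simp add: wedge11_def mult.commute)
  qed
qed

end
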